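(* For every horizon $T>0$ and every prior $\lambda^*\in\Delta$, full information revelation minimizes the expected makespan among all public signaling schemes: for every finite family $(\alpha_\xi,\mu^\xi)_{\xi\in\Xi}$ with $\alpha_\xi\in[0,1]$, $\mu^\xi\in\Delta$, $\sum_\xi\alpha_\xi=1$ and $\sum_\xi\alpha_\xi\mu^\xi=\lambda^*$, $$\sum_{\xi\in\Xi}\alpha_\xi M(\mu^\xi)\ \ge\ \sum_{s\in[d]}\lambda^*_s M(e_s),$$ where $e_s$ is the $s$-th unit vector (the right-hand side is the expected makespan of full information revelation, i.e., $\Xi=[d]$ and signal $s$ sent exactly when scenario $s$ is realized).
   Context: Parallel-link dynamic flow model with stochastic travel times. Fix $m,d\in\mathbb N$, capacities $\nu_1,\dots,\nu_m\in\mathbb Q_{>0}$, inflow rate $u\in\mathbb Q_{>0}$, and scenario-dependent travel times $\tau_{i,s}\in\mathbb Q_{\ge0}$ ($i\in[m]$, $s\in[d]$), $\tau_i=(\tau_{i,1},\dots,\tau_{i,d})^\top$. $\Delta=\{\mu\in[0,1]^d:\sum_s\mu_s=1\}$ is the set of beliefs. A flow is a family $f=(f_i)_{i\in[m]}$ of measurable $f_i:\mathbb R_{\ge0}\to\mathbb R_{\ge0}$ with $\sum_i f_i(\theta)=u$ for a.e. $\theta$; its queue lengths $z_i(\theta)$ are the absolutely continuous functions with $z_i(0)=0$ and, for a.e. $\theta$, $z_i'(\theta)=f_i(\theta)-\nu_i$ if $z_i(\theta)>0$, $z_i'(\theta)=\max\{f_i(\theta)-\nu_i,0\}$ if $z_i(\theta)=0$.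 For a belief $\mu$, a Bayesian dynamic equilibrium is a flow $f$ such that for a.e. $\theta\ge0$, every $i$ with $f_i(\theta)>0$ minimizes $\theta+z_i(\theta)/\nu_i+\mu^\top\tau_i$ over $[m]$. For a scenario $s$ and horizon $T$, $M_{T,s}(f)=\sup\{\theta+z_i(\theta)/\nu_i+\tau_{i,s}:\theta\in[0,T],i\in[m],f_i(\theta)>0\}$. For $\mu\in\Delta$ let $M(\mu)=\sup\{\sum_{s\in[d]}\mu_sM_{T,s}(f): f \text{ a Bayesian dynamic equilibrium for }\mu\}$ (worst-case expected makespan). A public signaling scheme corresponds to a finite convex decomposition $(\alpha_\xi,\mu^\xi)$ of the prior $\lambda^*$ into posterior beliefs, and its expected makespan is $\sum_\xi\alpha_\xi M(\mu^\xi)$. *)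

theory Defs
  imports "HOL-Analysis.Analysis"
begin

text \<open>Indices: links are [m] = {1..m}, scenarios are [d] = {1..d}.
  Capacities nu :: nat => real, travel times tau :: nat => nat => real (tau i s).
  Time is real; flows and queues are functions real => real, only values on
  the nonnegative reals matter.\<close>

definition beliefs :: "nat \<Rightarrow> (nat \<Rightarrow> real) set" where
  "beliefs d = {\<mu>. (\<forall>s\<in>{1..d}. 0 \<le> \<mu> s \<and> \<mu> s \<le> 1) \<and> (\<Sum>s\<in>{1..d}. \<mu> s) = 1}"

definition unit_vec :: "nat \<Rightarrow> nat \<Rightarrow> real" where
  "unit_vec s = (\<lambda>t. if t = s then 1 else 0)"

definition abs_cont_on_interval :: "(real \<Rightarrow> real) \<Rightarrow> real \<Rightarrow> real \<Rightarrow> bool" where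
  "abs_cont_on_interval z a b \<longleftrightarrow>
     (\<forall>\<epsilon>>0. \<exists>\<delta>>0. \<forall>(n::nat) (l::nat \<Rightarrow> real) (r::nat \<Rightarrow> real).
        (\<forall>k<n. a \<le> l k \<and> l k \<le> r k \<and> r k \<le> b) \<and>
        (\<forall>k. Suc k < n \<longrightarrow> r k \<le> l (Suc k)) \<and>
        (\<Sum>k<n. r k - l k) < \<delta>
        \<longrightarrow> (\<Sum>k<n. \<bar>z (r k) - z (l k)\<bar>) < \<epsilon>)"

definition is_flow :: "nat \<Rightarrow> real \<Rightarrow> (nat \<Rightarrow> real \<Rightarrow> real) \<Rightarrow> bool" where
  "is_flow m u f \<longleftrightarrow>
     (\<forall>i\<in>{1..m}. f i \<in> borel_measurable (restrict_space lborel {0..}) \<and>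
                 (\<forall>\<theta>\<ge>0. 0 \<le> f i \<theta>)) \<and>
     (AE \<theta> in lborel. 0 \<le> \<theta> \<longrightarrow> (\<Sum>i\<in>{1..m}. f i \<theta>) = u)"

definition is_queue :: "nat \<Rightarrow> (nat \<Rightarrow> real) \<Rightarrow> (nat \<Rightarrow> real \<Rightarrow> real) \<Rightarrow> (nat \<Rightarrow> real \<Rightarrow> real) \<Rightarrow> bool" where
  "is_queue m \<nu> f z \<longleftrightarrow>
     (\<forall>i\<in>{1..m}. z i 0 = 0 \<and> (\<forall>b\<ge>0. abs_cont_on_interval (z i) 0 b) \<and>
        (AE \<theta> in lborel. 0 < \<theta> \<longrightarrow>
           (z i has_real_derivative
              (if z i \<theta> > 0 then f i \<theta> - \<nu> i else max (f i \<theta> - \<nu> i) 0)) (at \<theta>)))"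

definition is_BDE :: "nat \<Rightarrow> nat \<Rightarrow> (nat \<Rightarrow> real) \<Rightarrow> real \<Rightarrow> (nat \<Rightarrow> nat \<Rightarrow> real)
    \<Rightarrow> (nat \<Rightarrow> real) \<Rightarrow> (nat \<Rightarrow> real \<Rightarrow> real) \<Rightarrow> (nat \<Rightarrow> real \<Rightarrow> real) \<Rightarrow> bool" where
  "is_BDE m d \<nu> u \<tau> \<mu> f z \<longleftrightarrow> is_flow m u f \<and> is_queue m \<nu> f z \<and>
     (AE \<theta> in lborel. 0 \<le> \<theta> \<longrightarrow>
        (\<forall>i\<in>{1..m}. f i \<theta> > 0 \<longrightarrow>
           (\<forall>j\<in>{1..m}. \<theta> + z i \<theta> / \<nu> i + (\<Sum>s\<in>{1..d}. \<mu> s * \<tau> i s)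
                       \<le> \<theta> + z j \<theta> / \<nu> j + (\<Sum>s\<in>{1..d}. \<mu> s * \<tau> j s))))"

definition makespan :: "nat \<Rightarrow> (nat \<Rightarrow> real) \<Rightarrow> (nat \<Rightarrow> nat \<Rightarrow> real) \<Rightarrow> real \<Rightarrow> nat
    \<Rightarrow> (nat \<Rightarrow> real \<Rightarrow> real) \<Rightarrow> (nat \<Rightarrow> real \<Rightarrow> real) \<Rightarrow> real" where
  "makespan m \<nu> \<tau> T s f z =
     Sup {\<theta> + z i \<theta> / \<nu> i + \<tau> i s | \<theta> i. \<theta> \<in> {0..T} \<and> i \<in> {1..m} \<and> f i \<theta> > 0}"

definition worst_exp_makespan :: "nat \<Rightarrow> nat \<Rightarrow> (nat \<Rightarrow> real) \<Rightarrow> real \<Rightarrow> (nat \<Rightarrow> nat \<Rightarrow> real)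
    \<Rightarrow> real \<Rightarrow> (nat \<Rightarrow> real) \<Rightarrow> real" where
  "worst_exp_makespan m d \<nu> u \<tau> T \<mu> =
     Sup {(\<Sum>s\<in>{1..d}. \<mu> s * makespan m \<nu> \<tau> T s f z) | f z. is_BDE m d \<nu> u \<tau> \<mu> f z}"

end

theory Submission
  imports Defs
begin

text \<open>
  Since flows may be changed on null sets without affecting the equilibrium property, the worst-case
  expected makespan for \<open>\<mu>\<close> is \<open>\<Sum>s. \<mu> s * W \<mu> s\<close>, where \<open>W \<mu> s\<close> is the maximum over all links \<open>i\<close>, used or
  not, of \<open>T + z i T / \<nu> i + \<tau> i s\<close> and \<open>z\<close> are the equilibrium queues. It therefore suffices to compare,
  in each scenario \<open>s\<close> separately, the equilibrium for the unit vector with the one for \<open>\<mu>\<close>. This rests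
  on the minimal delay over all links (the \<^emph>\<open>level\<close>) being monotone in the travel times: raising all
  travel times by a common constant raises the level by this constant, and the travel times for
  \<open>\<mu>\<close>, truncated at the final level, dominate those of scenario \<open>s\<close> up to the constant by which
  \<open>W \<mu> s\<close> exceeds the final level.
\<close>

subsection \<open>Growth of absolutely continuous functions\<close>

text \<open>By linearity, Bayes plausibility reduces the claim to one belief \<mu> at a time:
  \<open>M \<mu>\<close> must dominate the \<mu>-average of the values
  \<open>M (unit_vec s)\<close>. The obstacle to comparing levels is regularity. Flow and optimality
  are constrained only at almost every time, and a level is a minimum of queue delays with no
  derivative where the minimizing link changes. Sign arguments with derivatives are therefore
  replaced by upper bounds on left increments outside a null set, which suffice for absolutely
  continuous functions. Left increments fit minima: a link that is optimal at the good time
  \<open>x\<close> bounds the minimum at \<open>x - h\<close> from above. Since \<open>M\<close> is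
  a supremum over all equilibria, it carries information only if its set is nonempty and bounded.
  Nonemptiness comes from an explicit equilibrium. Boundedness comes from comparing two equilibria
  for the same belief, which takes the place of uniqueness of the queues.\<close>

definition nonoverlapping :: "real \<Rightarrow> real \<Rightarrow> nat \<Rightarrow> (nat \<Rightarrow> real) \<Rightarrow> (nat \<Rightarrow> real) \<Rightarrow> bool" where
  "nonoverlapping a b n l r \<longleftrightarrow>
     (\<forall>k<n. a \<le> l k \<and> l k \<le> r k \<and> r k \<le> b) \<and> (\<forall>k. Suc k < n \<longrightarrow> r k \<le> l (Suc k))"

lemma abs_cont_on_interval_iff:
  "abs_cont_on_interval z a b \<longleftrightarrow>
     (\<forall>\<epsilon>>0. \<exists>\<delta>>0. \<forall>n l r. nonoverlapping a b n l r \<longrightarrow> (\<Sum>k<n. r k - l k) < \<delta>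
        \<longrightarrow> (\<Sum>k<n. \<bar>z (r k) - z (l k)\<bar>) < \<epsilon>)"
  unfolding abs_cont_on_interval_def nonoverlapping_def by (simp only: conj_assoc imp_conjL)

lemma abs_cont_on_intervalD:
  assumes "abs_cont_on_interval z a b" "\<epsilon> > 0"
  shows "\<exists>\<delta>>0. \<forall>n l r. nonoverlapping a b n l r \<longrightarrow> (\<Sum>k<n. r k - l k) < \<delta>
        \<longrightarrow> (\<Sum>k<n. \<bar>z (r k) - z (l k)\<bar>) < \<epsilon>"
  by (rule assms(1)[unfolded abs_cont_on_interval_iff, THEN spec, THEN mp, OF assms(2)])

lemma abs_cont_on_intervalI:
  assumes "\<And>\<epsilon>. \<epsilon> > 0 \<Longrightarrow> \<exists>\<delta>>0. \<forall>n l r. nonoverlapping a b n l r \<longrightarrow> (\<Sum>k<n. r k - l k) < \<delta>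
        \<longrightarrow> (\<Sum>k<n. \<bar>z (r k) - z (l k)\<bar>) < \<epsilon>"
  shows "abs_cont_on_interval z a b"
  unfolding abs_cont_on_interval_iff by (intro allI impI, rule assms)

lemma abs_cont_on_interval_subset:
  assumes "abs_cont_on_interval g a b" "a \<le> a'" "b' \<le> b"
  shows "abs_cont_on_interval g a' b'"
proof (rule abs_cont_on_intervalI)
  fix e :: real assume e: "e > 0"
  obtain d where d: "d > 0"
    "\<forall>n l r. nonoverlapping a b n l r \<longrightarrow> (\<Sum>k<n. r k - l k) < d
       \<longrightarrow> (\<Sum>k<n. \<bar>g (r k) - g (l k)\<bar>) < e"
    using abs_cont_on_intervalD[OF assms(1) e] by (elim exE conjE)
  have "nonoverlapping a b n l r" if "nonoverlapping a' b' n l r" for n l r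
    using that assms(2,3) unfolding nonoverlapping_def by force
  then show "\<exists>\<delta>>0. \<forall>n l r. nonoverlapping a' b' n l r \<longrightarrow> (\<Sum>k<n. r k - l k) < \<delta>
        \<longrightarrow> (\<Sum>k<n. \<bar>g (r k) - g (l k)\<bar>) < e"
    using d by (intro exI[of _ d]) simp
qed

lemma abs_cont_on_interval_diff_linear:
  assumes "abs_cont_on_interval g a b"
  shows "abs_cont_on_interval (\<lambda>x. g x - c * x) a b"
proof (rule abs_cont_on_intervalI)
  fix e :: real assume e: "e > 0"
  obtain d where d: "d > 0"
    "\<forall>n l r. nonoverlapping a b n l r \<longrightarrow> (\<Sum>k<n. r k - l k) < d
       \<longrightarrow> (\<Sum>k<n. \<bar>g (r k) - g (l k)\<bar>) < e / 2"
    using abs_cont_on_intervalD[OF assms half_gt_zero[OF e]] by (elim exE conjE)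
  define d' where "d' = min d (e / (2 * (\<bar>c\<bar> + 1)))"
  have d'0: "d' > 0" using d(1) e by (auto simp: d'_def)
  have "(\<Sum>k<n. \<bar>(g (r k) - c * r k) - (g (l k) - c * l k)\<bar>) < e"
    if *: "nonoverlapping a b n l r" "(\<Sum>k<n. r k - l k) < d'" for n l r
  proof -
    have "(\<Sum>k<n. \<bar>(g (r k) - c * r k) - (g (l k) - c * l k)\<bar>)
        \<le> (\<Sum>k<n. \<bar>g (r k) - g (l k)\<bar> + \<bar>c\<bar> * (r k - l k))"
    proof (intro sum_mono)
      fix k assume "k \<in> {..<n}"
      then have "l k \<le> r k" using *(1) by (auto simp: nonoverlapping_def)
      then have "\<bar>c * (r k - l k)\<bar> = \<bar>c\<bar> * (r k - l k)" by (simp add: abs_mult)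
      then show "\<bar>(g (r k) - c * r k) - (g (l k) - c * l k)\<bar> \<le> \<bar>g (r k) - g (l k)\<bar> + \<bar>c\<bar> * (r k - l k)"
        by (simp add: algebra_simps)
    qed
    also have "\<dots> = (\<Sum>k<n. \<bar>g (r k) - g (l k)\<bar>) + \<bar>c\<bar> * (\<Sum>k<n. r k - l k)"
      by (simp add: sum.distrib sum_distrib_left)
    also have "\<dots> < e / 2 + e / 2"
    proof (intro add_less_le_mono)
      show "(\<Sum>k<n. \<bar>g (r k) - g (l k)\<bar>) < e / 2"
        using * by (intro d(2)[rule_format]) (auto simp: d'_def)
      have "\<bar>c\<bar> * (\<Sum>k<n. r k - l k) \<le> \<bar>c\<bar> * (e / (2 * (\<bar>c\<bar> + 1)))"
        using *(2) by (intro mult_left_mono) (auto simp: d'_def)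
      also have "\<dots> \<le> e / 2" using e by (simp add: field_simps)
      finally show "\<bar>c\<bar> * (\<Sum>k<n. r k - l k) \<le> e / 2" .
    qed
    finally show ?thesis by simp
  qed
  then show "\<exists>\<delta>>0. \<forall>n l r. nonoverlapping a b n l r \<longrightarrow> (\<Sum>k<n. r k - l k) < \<delta>
        \<longrightarrow> (\<Sum>k<n. \<bar>(g (r k) - c * r k) - (g (l k) - c * l k)\<bar>) < e"
    using d'0 by blast
qed

lemma abs_cont_on_interval_uminus:
  "abs_cont_on_interval g a b \<Longrightarrow> abs_cont_on_interval (\<lambda>x. - g x) a b"
proof -
  have "\<bar>- g x - - g y\<bar> = \<bar>g x - g y\<bar>" for x y by simp
  then show "abs_cont_on_interval g a b \<Longrightarrow> abs_cont_on_interval (\<lambda>x. - g x) a b"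
    by (simp only: abs_cont_on_interval_iff)
qed

lemma lipschitz_on_imp_abs_cont_on_interval:
  fixes g :: "real \<Rightarrow> real"
  assumes "C-lipschitz_on {a..b} g"
  shows "abs_cont_on_interval g a b"
proof (rule abs_cont_on_intervalI)
  fix e :: real assume e: "e > 0"
  have C: "C \<ge> 0" using assms lipschitz_on_nonneg by blast
  have "(\<Sum>k<n. \<bar>g (r k) - g (l k)\<bar>) < e"
    if *: "nonoverlapping a b n l r" "(\<Sum>k<n. r k - l k) < e / (C + 1)" for n l r
  proof -
    have "(\<Sum>k<n. \<bar>g (r k) - g (l k)\<bar>) \<le> (\<Sum>k<n. C * (r k - l k))"
    proof (intro sum_mono)
      fix k assume "k \<in> {..<n}"
      then have k: "a \<le> l k" "l k \<le> r k" "r k \<le> b" using *(1) by (auto simp: nonoverlapping_def)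
      then have "dist (g (r k)) (g (l k)) \<le> C * dist (r k) (l k)"
        by (intro lipschitz_onD[OF assms]) auto
      then show "\<bar>g (r k) - g (l k)\<bar> \<le> C * (r k - l k)" using k by (simp add: dist_real_def)
    qed
    also have "\<dots> = C * (\<Sum>k<n. r k - l k)" by (simp add: sum_distrib_left)
    also have "\<dots> \<le> C * (e / (C + 1))" using *(2) C by (intro mult_left_mono) auto
    also have "\<dots> < e" using e C by (simp add: field_simps)
    finally show ?thesis .
  qed
  then show "\<exists>\<delta>>0. \<forall>n l r. nonoverlapping a b n l r \<longrightarrow> (\<Sum>k<n. r k - l k) < \<delta>
        \<longrightarrow> (\<Sum>k<n. \<bar>g (r k) - g (l k)\<bar>) < e"
    using e C by (intro exI[of _ "e / (C + 1)"]) auto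
qed

lemma abs_cont_on_interval_imp_continuous_on:
  assumes "abs_cont_on_interval g a b"
  shows "continuous_on {a..b} g"
  unfolding continuous_on_iff
proof (intro ballI allI impI)
  fix x e :: real assume x: "x \<in> {a..b}" and e: "e > 0"
  obtain d where d: "d > 0"
    "\<forall>n l r. nonoverlapping a b n l r \<longrightarrow> (\<Sum>k<n. r k - l k) < d
       \<longrightarrow> (\<Sum>k<n. \<bar>g (r k) - g (l k)\<bar>) < e"
    using abs_cont_on_intervalD[OF assms e] by (elim exE conjE)
  have "dist (g y) (g x) < e" if "y \<in> {a..b}" "dist y x < d" for y
    using d(2)[rule_format, of 1 "\<lambda>_. min x y" "\<lambda>_. max x y"] that x
    by (cases "x \<le> y") (auto simp: nonoverlapping_def dist_real_def)
  then show "\<exists>d>0. \<forall>x'\<in>{a..b}. dist x' x < d \<longrightarrow> dist (g x') (g x) < e"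
    using d(1) by blast
qed

section \<open>Monotonicity of absolutely continuous functions outside a null set\<close>

lemma sum_nonoverlapping_le_measure:
  assumes lr: "nonoverlapping a b n l r" and sub: "\<And>k. k < n \<Longrightarrow> {l k..r k} \<subseteq> U"
    and U: "U \<in> lmeasurable"
  shows "(\<Sum>k<n. r k - l k) \<le> measure lebesgue U"
proof -
  have le: "l k \<le> r k" if "k < n" for k
    using that lr by (auto simp: nonoverlapping_def)
  have sep: "r j \<le> l k" if "j < k" "k < n" for j k
    using that
  proof (induction k)
    case (Suc k)
    have "r k \<le> l (Suc k)" using lr Suc.prems by (auto simp: nonoverlapping_def)
    moreover have "r j \<le> r k"
    proof (cases "j = k")
      case False
      then have "r j \<le> l k" using Suc by auto
      also have "\<dots> \<le> r k" using Suc.prems by (intro le) auto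
      finally show ?thesis .
    qed simp
    ultimately show ?case by linarith
  qed simp
  \<comment> \<open>Half-open pieces keep the lengths but are disjoint even where neighbouring
    closed intervals share an endpoint, so measure is additive.\<close>
  have "(\<Sum>k<n. r k - l k) = (\<Sum>k<n. measure lebesgue {l k<..r k})"
    using le by (intro sum.cong) auto
  also have "\<dots> = measure lebesgue (\<Union>k\<in>{..<n}. {l k<..r k})"
  proof (rule measure_finite_Union[symmetric])
    show "disjoint_family_on (\<lambda>k. {l k<..r k}) {..<n}"
      unfolding disjoint_family_on_def
    proof (intro ballI impI)
      fix i j assume "i \<in> {..<n}" "j \<in> {..<n}" "i \<noteq> j"
      then show "{l i<..r i} \<inter> {l j<..r j} = {}"
        using sep[of i j] sep[of j i] by (cases "i < j") auto
    qed
    show "emeasure lebesgue {l k<..r k} \<noteq> \<infinity>" if "k \<in> {..<n}" for k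
      using that le by simp
  qed auto
  also have "\<dots> \<le> measure lebesgue U"
  proof (rule measure_mono_fmeasurable)
    have "{l k<..r k} \<subseteq> U" if "k < n" for k
      using sub[OF that] by force
    then show "(\<Union>k\<in>{..<n}. {l k<..r k}) \<subseteq> U" by blast
  qed (use U in auto)
  finally show ?thesis .
qed

text \<open>Real induction from the right end point. Inside an open cover \<open>U\<close> of small measure of the
  exceptional set, the growth of \<open>g\<close> is charged to its variation over \<open>U\<close>, which absolute
  continuity makes small; outside, it is controlled by the left difference quotients.\<close>

lemma abs_cont_decreasing_ae:
  fixes g :: "real \<Rightarrow> real"
  assumes ac: "abs_cont_on_interval g a b" and ab: "a \<le> b" and N: "negligible N"
    and left: "\<And>x e. a < x \<Longrightarrow> x \<le> b \<Longrightarrow> x \<notin> N \<Longrightarrow> e > 0 \<Longrightarrow>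
       \<exists>d>0. \<forall>h. 0 < h \<and> h < d \<and> a \<le> x - h \<longrightarrow> g x - g (x - h) \<le> e * h"
  shows "g b \<le> g a"
proof -
  \<comment> \<open>Two error terms: slope \<open>e\<close> accumulated outside the exceptional set,
    and variation at most \<open>e\<close> inside its open cover.\<close>
  have main: "g b - g a \<le> e * (b - a) + e" if e: "e > 0" for e
  proof -
    obtain \<delta> where \<delta>: "\<delta> > 0"
      "\<forall>n l r. nonoverlapping a b n l r \<longrightarrow> (\<Sum>k<n. r k - l k) < \<delta>
         \<longrightarrow> (\<Sum>k<n. \<bar>g (r k) - g (l k)\<bar>) < e"
      using abs_cont_on_intervalD[OF ac e] by (elim exE conjE)
    have Nn: "N \<in> null_sets lebesgue" using N negligible_iff_null_sets by blast
    obtain U where U: "open U" "N \<subseteq> U" "U - N \<in> lmeasurable" "emeasure lebesgue (U - N) < ennreal \<delta>"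
      using sets_lebesgue_outer_open[OF _ \<open>\<delta> > 0\<close>, of N] Nn by (auto simp: null_sets_def)
    have emU: "emeasure lebesgue U = emeasure lebesgue (U - N)"
      using emeasure_Diff_null_set[OF Nn, of U] U(1) by simp
    have Ul: "U \<in> lmeasurable"
      using U(1,4) emU by (intro fmeasurableI) (auto intro: order.strict_trans)
    have Ud: "measure lebesgue U < \<delta>"
      using U(4) emU emeasure_eq_measure2[OF Ul] by (metis ennreal_less_iff measure_nonneg)
    \<comment> \<open>\<open>V x\<close> is the variation of \<open>g\<close> over families of
      intervals contained in \<open>U\<close> and in \<open>[x, b]\<close>. It serves as a budget
      that is spent whenever the induction moves left through \<open>U\<close>.\<close>
    define adm where "adm x n l r \<longleftrightarrow> nonoverlapping x b n l r \<and> (\<forall>k<n. {l k..r k} \<subseteq> U)"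
      for x and n :: nat and l r :: "nat \<Rightarrow> real"
    define S where "S x = {(\<Sum>k<n. \<bar>g (r k) - g (l k)\<bar>) | (n::nat) l r. adm x n l r}" for x
    define V where "V x = Sup (S x)" for x
    have Sle: "v \<le> e" if v: "v \<in> S x" and x: "a \<le> x" for v x
    proof -
      obtain n l r where nlr: "adm x n l r" "v = (\<Sum>k<n. \<bar>g (r k) - g (l k)\<bar>)"
        using v by (auto simp: S_def)
      have "nonoverlapping a b n l r"
        using nlr(1) x by (force simp: adm_def nonoverlapping_def)
      moreover have "(\<Sum>k<n. r k - l k) < \<delta>"
        using sum_nonoverlapping_le_measure[of x b n l r U] nlr(1) Ul Ud by (force simp: adm_def)
      ultimately show ?thesis using \<delta>(2) nlr(2) by fastforce
    qed
    have S0: "0 \<in> S x" for x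
      unfolding S_def adm_def nonoverlapping_def by (auto intro!: exI[of _ "0::nat"])
    have bdd: "bdd_above (S x)" if "a \<le> x" for x
      using Sle[OF _ that] by (auto simp: bdd_above_def)
    have V0: "V x \<ge> 0" if "a \<le> x" for x
      unfolding V_def using bdd[OF that] S0 by (rule cSup_upper[rotated])
    have Vle: "V x \<le> e" if "a \<le> x" for x
      unfolding V_def using S0 Sle[OF _ that] by (intro cSup_least) auto
    have Vmono: "V y \<le> V x" if "a \<le> x" "x \<le> y" for x y
      unfolding V_def
    proof (rule cSup_subset_mono)
      have "adm x n l r" if "adm y n l r" for n l r
        using that \<open>x \<le> y\<close> by (force simp: adm_def nonoverlapping_def)
      then show "S y \<subseteq> S x" unfolding S_def by blast
    qed (use S0 bdd that in auto)
    have Vadd: "V y + \<bar>g y - g x\<bar> \<le> V x" if xy: "a \<le> x" "x \<le> y" "y \<le> b" "{x..y} \<subseteq> U" for x y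
    proof -
      have "v \<le> V x - \<bar>g y - g x\<bar>" if v: "v \<in> S y" for v
      proof -
        obtain n l r where nlr: "adm y n l r" "v = (\<Sum>k<n. \<bar>g (r k) - g (l k)\<bar>)"
          using v by (auto simp: S_def)
        \<comment> \<open>\<open>case_nat\<close> prepends \<open>[x, y]\<close>; the left-to-right
          order of the families makes this admissible.\<close>
        define l' r' where "l' = case_nat x l" and "r' = case_nat y r"
        have "adm x (Suc n) l' r'"
          using nlr(1) xy unfolding adm_def nonoverlapping_def l'_def r'_def
          by (force split: nat.split simp: less_Suc_eq_0_disj)
        then have "(\<Sum>k<Suc n. \<bar>g (r' k) - g (l' k)\<bar>) \<in> S x"
          unfolding S_def by blast
        then have "(\<Sum>k<Suc n. \<bar>g (r' k) - g (l' k)\<bar>) \<le> V x"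
          unfolding V_def using bdd[OF xy(1)] by (rule cSup_upper)
        moreover have "(\<Sum>k<Suc n. \<bar>g (r' k) - g (l' k)\<bar>) = \<bar>g y - g x\<bar> + v"
          by (subst sum.lessThan_Suc_shift) (simp add: l'_def r'_def nlr(2))
        ultimately show ?thesis by simp
      qed
      then have "V y \<le> V x - \<bar>g y - g x\<bar>"
        unfolding V_def[of y] using S0[of y] by (intro cSup_least) auto
      then show ?thesis by simp
    qed
    \<comment> \<open>The points from which the desired estimate up to \<open>b\<close> already
      holds; the aim is to show that the infimum is \<open>a\<close>.\<close>
    define D where "D = {x \<in> {a..b}. g b - g x \<le> e * (b - x) + V x}"
    define m where "m = Inf D"
    have bD: "b \<in> D" using ab V0[of b] by (auto simp: D_def)
    have Dbdd: "bdd_below D" by (auto simp: D_def bdd_below_def)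
    have mb: "m \<le> b" unfolding m_def using bD Dbdd by (rule cInf_lower)
    have am: "a \<le> m" unfolding m_def using bD by (intro cInf_greatest) (auto simp: D_def)
    have cont: "continuous_on {a..b} g" using ac by (rule abs_cont_on_interval_imp_continuous_on)
    \<comment> \<open>Continuity of \<open>V\<close> is avoided: \<open>V\<close> is antitone, so
      points of \<open>D\<close> to the right of \<open>m\<close> have value at most
      \<open>V m\<close>, and continuity of \<open>g\<close> finishes the limit.\<close>
    have "m \<in> D"
    proof (rule ccontr)
      assume "m \<notin> D"
      then have gap: "g b - g m - e * (b - m) - V m > 0" (is "?\<eta> > 0")
        using am mb by (auto simp: D_def)
      obtain d where d: "d > 0" "\<forall>y\<in>{a..b}. dist y m < d \<longrightarrow> dist (g y) (g m) < ?\<eta>"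
        using cont gap am mb unfolding continuous_on_iff by (meson atLeastAtMost_iff)
      obtain x where x: "x \<in> D" "x < m + d"
        using cInf_lessD[of D "m + d"] bD d(1) m_def by fastforce
      have mx: "m \<le> x" unfolding m_def using x(1) Dbdd by (rule cInf_lower)
      have "\<bar>g x - g m\<bar> < ?\<eta>" using d(2) x mx by (auto simp: D_def dist_real_def)
      moreover have "g b - g x \<le> e * (b - m) + V m"
      proof -
        have "e * (b - x) \<le> e * (b - m)" using e mx by (intro mult_left_mono) auto
        then show ?thesis using x(1) Vmono[OF am mx] by (auto simp: D_def)
      qed
      ultimately show False by linarith
    qed
    have "m = a"
    proof (rule ccontr)
      assume "m \<noteq> a"
      then have am': "a < m" using am by simp
      have "\<exists>h>0. m - h \<in> D"
      proof (cases "m \<in> N")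
        case True
        then obtain d where d: "d > 0" "\<And>y. dist y m < d \<Longrightarrow> y \<in> U"
          using U(1,2) unfolding open_dist by (metis subsetD)
        define h where "h = min (d / 2) (m - a)"
        have h: "h > 0" "h < d" "a \<le> m - h" using d(1) am' by (auto simp: h_def)
        have "{m - h..m} \<subseteq> U" using h(2) by (auto intro!: d(2) simp: dist_real_def)
        then have "V m + \<bar>g m - g (m - h)\<bar> \<le> V (m - h)" using h mb by (intro Vadd) auto
        moreover have "e * (b - m) \<le> e * (b - (m - h))" using h e by (intro mult_left_mono) auto
        ultimately have "m - h \<in> D" using \<open>m \<in> D\<close> h by (auto simp: D_def)
        then show ?thesis using h(1) by blast
      next
        case False
        obtain d where d: "d > 0" "\<forall>h. 0 < h \<and> h < d \<and> a \<le> m - h \<longrightarrow> g m - g (m - h) \<le> e * h"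
          using left[OF am' mb False e] by blast
        define h where "h = min (d / 2) (m - a)"
        have h: "h > 0" "h < d" "a \<le> m - h" using d(1) am' by (auto simp: h_def)
        have "g m - g (m - h) \<le> e * h" using d(2) h by blast
        moreover have "V m \<le> V (m - h)" using h by (intro Vmono) auto
        moreover have "e * (b - (m - h)) = e * (b - m) + e * h" by (simp add: algebra_simps)
        ultimately have "m - h \<in> D" using \<open>m \<in> D\<close> h by (auto simp: D_def)
        then show ?thesis using h(1) by blast
      qed
      then obtain h where "h > 0" "m - h \<in> D" by blast
      then have "m \<le> m - h" unfolding m_def[symmetric] using Dbdd cInf_lower m_def by metis
      with \<open>h > 0\<close> show False by simp
    qed
    then have "g b - g a \<le> e * (b - a) + V a" using \<open>m \<in> D\<close> by (auto simp: D_def)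
    then show ?thesis using Vle[of a] by simp
  qed
  show ?thesis
  proof (rule ccontr)
    assume "\<not> g b \<le> g a"
    \<comment> \<open>With this scaling the total error \<open>e * (b - a) + e\<close> is exactly
      half of the supposed gain; the summand 1 keeps \<open>L\<close> positive when
      \<open>a = b\<close>.\<close>
    define L where "L = b - a + 1"
    have L: "L > 0" using ab by (simp add: L_def)
    define e where "e = (g b - g a) / (2 * L)"
    have e: "e > 0" using \<open>\<not> g b \<le> g a\<close> L by (simp add: e_def)
    have "e * L = (g b - g a) / 2" using L by (simp add: e_def)
    then have "e * (b - a) + e = (g b - g a) / 2" by (simp add: L_def distrib_left)
    then show False using main[OF e] e \<open>\<not> g b \<le> g a\<close> by simp
  qed
qed

text \<open>After the last time with \<open>g \<le> 0\<close> the function is positive, so the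
  increment bound applies on all of that remaining interval and forbids growth. Hence bounds are
  needed only where \<open>g\<close> is positive, which is where the comparison arguments have
  information.\<close>

lemma abs_cont_nonpos_ae:
  fixes g :: "real \<Rightarrow> real"
  assumes ac: "abs_cont_on_interval g a b" and ab: "a \<le> b" and N: "negligible N" and ga: "g a \<le> 0"
    and left: "\<And>x e. a < x \<Longrightarrow> x \<le> b \<Longrightarrow> x \<notin> N \<Longrightarrow> g x > 0 \<Longrightarrow> e > 0 \<Longrightarrow>
       \<exists>d>0. \<forall>h. 0 < h \<and> h < d \<and> a \<le> x - h \<longrightarrow> g x - g (x - h) \<le> e * h"
  shows "g b \<le> 0"
proof (rule ccontr)
  assume gb: "\<not> g b \<le> 0"
  have cont: "continuous_on {a..b} g" using ac by (rule abs_cont_on_interval_imp_continuous_on)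
  define D where "D = {x \<in> {a..b}. g x \<le> 0}"
  have "closed D" unfolding D_def
    using continuous_closed_preimage[OF cont closed_atLeastAtMost closed_atMost, of 0]
    by (simp add: vimage_def Int_def)
  moreover have "D \<noteq> {}" "bdd_above D" using ga ab by (auto simp: D_def bdd_above_def)
  ultimately have tD: "Sup D \<in> D" and up: "\<And>x. x \<in> D \<Longrightarrow> x \<le> Sup D"
    by (auto intro: closed_contains_Sup cSup_upper)
  define t where "t = Sup D"
  have t: "a \<le> t" "t \<le> b" "g t \<le> 0" using tD by (auto simp: t_def D_def)
  have pos: "g x > 0" if "t < x" "x \<le> b" for x
    using up[of x] that t by (fastforce simp: t_def D_def)
  have "g b \<le> g t"
  proof (rule abs_cont_decreasing_ae[OF abs_cont_on_interval_subset[OF ac t(1)] t(2) N])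
    fix x e :: real assume x: "t < x" "x \<le> b" "x \<notin> N" "e > 0"
    then show "\<exists>d>0. \<forall>h. 0 < h \<and> h < d \<and> t \<le> x - h \<longrightarrow> g x - g (x - h) \<le> e * h"
      using left[of x e] pos[of x] t by fastforce
  qed simp
  then show False using gb t by simp
qed

lemma has_real_derivative_left_increment_le:
  assumes "(g has_real_derivative D) (at x)" "D \<le> c" "e > 0"
  shows "\<exists>d>0. \<forall>h. 0 < h \<and> h < d \<longrightarrow> g x - g (x - h) \<le> (c + e) * h"
proof -
  have "((\<lambda>h. (g (x + h) - g x) / h) \<longlongrightarrow> D) (at 0)"
    using assms(1) by (simp add: DERIV_def)
  from LIM_D[OF this assms(3)] obtain d where d: "d > 0"
    "\<And>h. h \<noteq> 0 \<Longrightarrow> \<bar>h\<bar> < d \<Longrightarrow> \<bar>(g (x + h) - g x) / h - D\<bar> < e" by auto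
  have "g x - g (x - h) \<le> (c + e) * h" if "0 < h" "h < d" for h
  proof -
    have "(g (x - h) - g x) / (- h) < c + e" using d(2)[of "-h"] that assms(2) by (simp add: abs_less_iff)
    then show ?thesis using that by (simp add: field_simps)
  qed
  then show ?thesis using d(1) by blast
qed

lemma abs_cont_growth_le:
  fixes g :: "real \<Rightarrow> real"
  assumes ac: "abs_cont_on_interval g a b" and ab: "a \<le> b" and N: "negligible N"
    and der: "\<And>x. a < x \<Longrightarrow> x \<le> b \<Longrightarrow> x \<notin> N \<Longrightarrow> \<exists>D\<le>c. (g has_real_derivative D) (at x)"
  shows "g b - g a \<le> c * (b - a)"
proof -
  have "g b - c * b \<le> g a - c * a"
  proof (rule abs_cont_decreasing_ae[OF abs_cont_on_interval_diff_linear[OF ac] ab N])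
    fix x e :: real assume x: "a < x" "x \<le> b" "x \<notin> N" "e > 0"
    obtain D where D: "D \<le> c" "(g has_real_derivative D) (at x)" using der x by blast
    obtain d where "d > 0" "\<forall>h. 0 < h \<and> h < d \<longrightarrow> g x - g (x - h) \<le> (c + e) * h"
      using has_real_derivative_left_increment_le[OF D(2,1) \<open>e > 0\<close>] by blast
    then show "\<exists>d>0. \<forall>h. 0 < h \<and> h < d \<and> a \<le> x - h \<longrightarrow>
        (g x - c * x) - (g (x - h) - c * (x - h)) \<le> e * h"
      by (intro exI[of _ d]) (auto simp: algebra_simps)
  qed
  then show ?thesis by (simp add: algebra_simps)
qed

subsection \<open>Comparison of equilibria\<close>

locale parallel_links =
  fixes S :: "'i set" and \<nu> :: "'i \<Rightarrow> real" and u :: real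
  assumes finite_links: "finite S" and links_nonempty: "S \<noteq> {}"
    and capacity_pos: "\<And>i. i \<in> S \<Longrightarrow> \<nu> i > 0" and inflow_pos: "u > 0"
begin

definition level :: "('i \<Rightarrow> real) \<Rightarrow> ('i \<Rightarrow> real \<Rightarrow> real) \<Rightarrow> real \<Rightarrow> real" where
  "level a z \<theta> = Min ((\<lambda>i. z i \<theta> / \<nu> i + a i) ` S)"

definition queue_rate :: "('i \<Rightarrow> real \<Rightarrow> real) \<Rightarrow> ('i \<Rightarrow> real \<Rightarrow> real) \<Rightarrow> 'i \<Rightarrow> real \<Rightarrow> real" where
  "queue_rate f z i \<theta> = (if z i \<theta> > 0 then f i \<theta> - \<nu> i else max (f i \<theta> - \<nu> i) 0)"

text \<open>The departure time is common to all links and cancels, so optimality of a used link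
  becomes equality with \<open>level\<close>.\<close>

definition balanced :: "('i \<Rightarrow> real) \<Rightarrow> ('i \<Rightarrow> real \<Rightarrow> real) \<Rightarrow> ('i \<Rightarrow> real \<Rightarrow> real) \<Rightarrow> real \<Rightarrow> bool" where
  "balanced a f z \<theta> \<longleftrightarrow> (\<Sum>i\<in>S. f i \<theta>) = u \<and>
     (\<forall>i\<in>S. 0 \<le> f i \<theta> \<and> (z i has_real_derivative queue_rate f z i \<theta>) (at \<theta>) \<and>
        (f i \<theta> > 0 \<longrightarrow> z i \<theta> / \<nu> i + a i = level a z \<theta>))"

text \<open>Queues need not be empty at time 0, so that the notion is invariant under time shifts.\<close>

definition equilibrium :: "('i \<Rightarrow> real) \<Rightarrow> real \<Rightarrow> ('i \<Rightarrow> real \<Rightarrow> real) \<Rightarrow> ('i \<Rightarrow> real \<Rightarrow> real) \<Rightarrow> bool" where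
  "equilibrium a T f z \<longleftrightarrow>
     (\<exists>C. \<forall>i\<in>S. C-lipschitz_on {0..T} (z i)) \<and> (\<forall>i\<in>S. \<forall>\<theta>\<in>{0..T}. 0 \<le> z i \<theta>) \<and>
     (\<exists>N. negligible N \<and> (\<forall>\<theta>. 0 < \<theta> \<and> \<theta> \<le> T \<and> \<theta> \<notin> N \<longrightarrow> balanced a f z \<theta>))"

lemma equilibrium_nonneg: "equilibrium a T f z \<Longrightarrow> i \<in> S \<Longrightarrow> 0 \<le> \<theta> \<Longrightarrow> \<theta> \<le> T \<Longrightarrow> 0 \<le> z i \<theta>"
  by (simp add: equilibrium_def)

lemma equilibrium_balancedE:
  assumes "equilibrium a T f z"
  obtains N where "negligible N"
    "\<And>\<theta>. 0 < \<theta> \<Longrightarrow> \<theta> \<le> T \<Longrightarrow> \<theta> \<notin> N \<Longrightarrow> balanced a f z \<theta>"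
proof -
  obtain N where "negligible N" "\<forall>\<theta>. 0 < \<theta> \<and> \<theta> \<le> T \<and> \<theta> \<notin> N \<longrightarrow> balanced a f z \<theta>"
    using assms unfolding equilibrium_def by (elim conjE exE)
  then show thesis by (intro that[of N]) auto
qed

lemma
  assumes "balanced a f z \<theta>"
  shows balanced_sum: "(\<Sum>i\<in>S. f i \<theta>) = u"
    and balanced_flow_nonneg: "i \<in> S \<Longrightarrow> 0 \<le> f i \<theta>"
    and balanced_deriv: "i \<in> S \<Longrightarrow> (z i has_real_derivative queue_rate f z i \<theta>) (at \<theta>)"
    and balanced_minimal: "i \<in> S \<Longrightarrow> f i \<theta> > 0 \<Longrightarrow> z i \<theta> / \<nu> i + a i = level a z \<theta>"
  using assms by (auto simp: balanced_def)

lemma level_le: "i \<in> S \<Longrightarrow> level a z \<theta> \<le> z i \<theta> / \<nu> i + a i"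
  unfolding level_def using finite_links by (intro Min_le) auto

lemma level_attained: "\<exists>i\<in>S. level a z \<theta> = z i \<theta> / \<nu> i + a i"
proof -
  have "level a z \<theta> \<in> (\<lambda>i. z i \<theta> / \<nu> i + a i) ` S"
    unfolding level_def using finite_links links_nonempty by (intro Min_in) auto
  then show ?thesis by auto
qed

lemma level_geI: "(\<And>i. i \<in> S \<Longrightarrow> c \<le> z i \<theta> / \<nu> i + a i) \<Longrightarrow> c \<le> level a z \<theta>"
  using level_attained[of a z \<theta>] by auto

lemma ge_queue_rate: "f i \<theta> - \<nu> i \<le> queue_rate f z i \<theta>"
  by (auto simp: queue_rate_def)

lemma equilibrium_lipschitz:
  assumes "equilibrium a T f z"
  shows "\<exists>C. (\<forall>i\<in>S. C-lipschitz_on {0..T} (\<lambda>\<theta>. z i \<theta> / \<nu> i + a i)) \<and> C-lipschitz_on {0..T} (level a z)"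
proof -
  obtain C where C: "\<And>i. i \<in> S \<Longrightarrow> C-lipschitz_on {0..T} (z i)"
    using assms by (auto simp: equilibrium_def)
  have C0: "C \<ge> 0" using C links_nonempty lipschitz_on_nonneg by blast
  define K where "K = (\<Sum>i\<in>S. C / \<nu> i)"
  have K: "C / \<nu> i \<le> K" if "i \<in> S" for i
    unfolding K_def using that finite_links C0 less_imp_le[OF capacity_pos]
    by (intro member_le_sum) auto
  have K0: "K \<ge> 0" unfolding K_def using C0 less_imp_le[OF capacity_pos] by (intro sum_nonneg) auto
  have links: "K-lipschitz_on {0..T} (\<lambda>\<theta>. z i \<theta> / \<nu> i + a i)" if i: "i \<in> S" for i
  proof (rule lipschitz_onI[OF _ K0])
    fix x y assume xy: "x \<in> {0..T}" "y \<in> {0..T}"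
    have "\<bar>z i x - z i y\<bar> \<le> C * \<bar>x - y\<bar>"
      using lipschitz_onD[OF C[OF i] xy] by (simp add: dist_real_def)
    then have "\<bar>z i x - z i y\<bar> / \<nu> i \<le> C * \<bar>x - y\<bar> / \<nu> i"
      using capacity_pos[OF i] by (intro divide_right_mono) auto
    also have "\<dots> \<le> K * \<bar>x - y\<bar>"
      using mult_right_mono[OF K[OF i], of "\<bar>x - y\<bar>"] by simp
    finally show "dist (z i x / \<nu> i + a i) (z i y / \<nu> i + a i) \<le> K * dist x y"
      using capacity_pos[OF i] by (simp add: dist_real_def diff_divide_distrib[symmetric])
  qed
  have "level a z x \<le> level a z y + K * \<bar>x - y\<bar>" if xy: "x \<in> {0..T}" "y \<in> {0..T}" for x y
  proof -
    obtain i where i: "i \<in> S" "level a z y = z i y / \<nu> i + a i" using level_attained by blast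
    have "\<bar>(z i x / \<nu> i + a i) - (z i y / \<nu> i + a i)\<bar> \<le> K * \<bar>x - y\<bar>"
      using lipschitz_onD[OF links[OF i(1)] xy] by (simp only: dist_real_def)
    then show ?thesis using level_le[OF i(1), of a z x] i(2) by linarith
  qed
  note lev = this
  have "K-lipschitz_on {0..T} (level a z)"
  proof (rule lipschitz_onI[OF _ K0])
    fix x y assume "x \<in> {0..T}" "y \<in> {0..T}"
    then show "dist (level a z x) (level a z y) \<le> K * dist x y"
      using lev[of x y] lev[of y x] by (simp add: dist_real_def abs_minus_commute[of y x])
  qed
  then show ?thesis using links by blast
qed

lemma equilibrium_restrict:
  assumes "equilibrium a T f z" "T' \<le> T"
  shows "equilibrium a T' f z"
proof -
  have "{0..T'} \<subseteq> {0..T}" using assms(2) by auto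
  then show ?thesis
    using assms unfolding equilibrium_def by (meson lipschitz_on_subset order_trans subsetD)
qed

lemma equilibrium_shift:
  assumes eq: "equilibrium a T f z" and s: "0 \<le> s"
  shows "equilibrium a (T - s) (\<lambda>i \<theta>. f i (\<theta> + s)) (\<lambda>i \<theta>. z i (\<theta> + s))"
proof -
  obtain C where C: "\<And>i. i \<in> S \<Longrightarrow> C-lipschitz_on {0..T} (z i)"
    using eq unfolding equilibrium_def by blast
  obtain N where N: "negligible N"
    "\<And>\<theta>. 0 < \<theta> \<Longrightarrow> \<theta> \<le> T \<Longrightarrow> \<theta> \<notin> N \<Longrightarrow> balanced a f z \<theta>"
    using equilibrium_balancedE[OF eq] by blast
  define N' where "N' = (+) (- s) ` N"
  have N': "negligible N'" unfolding N'_def using N(1) by (rule negligible_translation)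
  have mem: "\<theta> + s \<in> N \<Longrightarrow> \<theta> \<in> N'" for \<theta>
    unfolding N'_def by (rule image_eqI[of _ _ "\<theta> + s"]) auto
  have "C-lipschitz_on {0..T - s} (\<lambda>\<theta>. z i (\<theta> + s))" if "i \<in> S" for i
  proof (rule lipschitz_onI[OF _ lipschitz_on_nonneg[OF C[OF that]]])
    fix x y assume xy: "x \<in> {0..T - s}" "y \<in> {0..T - s}"
    then show "dist (z i (x + s)) (z i (y + s)) \<le> C * dist x y"
      using lipschitz_onD[OF C[OF that], of "x + s" "y + s"] s by simp
  qed
  moreover have "0 \<le> z i (\<theta> + s)" if "i \<in> S" "\<theta> \<in> {0..T - s}" for i \<theta>
    using equilibrium_nonneg[OF eq, of i "\<theta> + s"] that s by auto
  moreover have "balanced a (\<lambda>i \<theta>. f i (\<theta> + s)) (\<lambda>i \<theta>. z i (\<theta> + s)) \<theta>"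
    if "0 < \<theta>" "\<theta> \<le> T - s" "\<theta> \<notin> N'" for \<theta>
  proof -
    have "0 < \<theta> + s" "\<theta> + s \<le> T" "\<theta> + s \<notin> N" using that s mem by auto
    note N(2)[OF this]
    moreover have "level a (\<lambda>i \<theta>. z i (\<theta> + s)) \<theta> = level a z (\<theta> + s)"
      by (simp add: level_def)
    ultimately show ?thesis by (auto simp: balanced_def queue_rate_def DERIV_shift)
  qed
  ultimately show ?thesis
    unfolding equilibrium_def using N' by (intro conjI exI[of _ C] exI[of _ N']) auto
qed

section \<open>First-in-first-out and optimality of links with a queue\<close>

lemma equilibrium_queue_decrease_le:
  assumes eq: "equilibrium a T f z" and i: "i \<in> S" and xy: "0 \<le> x" "x \<le> y" "y \<le> T"
  shows "z i x - z i y \<le> \<nu> i * (y - x)"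
proof -
  obtain C where C: "C-lipschitz_on {0..T} (z i)"
    using eq i unfolding equilibrium_def by blast
  obtain N where N: "negligible N"
    "\<And>\<theta>. 0 < \<theta> \<Longrightarrow> \<theta> \<le> T \<Longrightarrow> \<theta> \<notin> N \<Longrightarrow> balanced a f z \<theta>"
    using equilibrium_balancedE[OF eq] by blast
  have "- z i y - - z i x \<le> \<nu> i * (y - x)"
  proof (rule abs_cont_growth_le[OF _ xy(2) N(1)])
    show "abs_cont_on_interval (\<lambda>x. - z i x) x y"
      by (rule abs_cont_on_interval_uminus[OF abs_cont_on_interval_subset[OF
            lipschitz_on_imp_abs_cont_on_interval[OF C] xy(1,3)]])
    fix \<theta> assume "x < \<theta>" "\<theta> \<le> y" "\<theta> \<notin> N"
    then have "0 \<le> f i \<theta>" "((\<lambda>x. - z i x) has_real_derivative - queue_rate f z i \<theta>) (at \<theta>)"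
      using N(2)[of \<theta>] xy balanced_flow_nonneg balanced_deriv i by (auto intro!: derivative_intros)
    then show "\<exists>D\<le>\<nu> i. ((\<lambda>x. - z i x) has_real_derivative D) (at \<theta>)"
      using ge_queue_rate[of f i \<theta> z] by (intro exI[of _ "- queue_rate f z i \<theta>"]) auto
  qed
  then show ?thesis by simp
qed

text \<open>The first-in-first-out property: waiting shrinks no faster than time passes. It limits
  the drop of the level and makes the arrival times on each link largest at the horizon.\<close>

lemma equilibrium_link_time_mono:
  assumes "equilibrium a T f z" "i \<in> S" "0 \<le> x" "x \<le> y" "y \<le> T"
  shows "x + z i x / \<nu> i \<le> y + z i y / \<nu> i"
proof -
  have "(z i x - z i y) / \<nu> i \<le> y - x"
    using equilibrium_queue_decrease_le[OF assms] capacity_pos[OF assms(2)]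
    by (simp add: divide_le_eq mult.commute)
  then show ?thesis by (simp add: diff_divide_distrib)
qed

text \<open>Extends optimality from links receiving flow to links holding a queue, and from almost
  every time to every time. A nonoptimal link gets no inflow, so its waiting time falls at rate 1,
  while by first-in-first-out the level falls at rate at most 1. Thus the excess over the level
  cannot grow while there is a queue.\<close>

lemma equilibrium_positive_queue_minimal:
  assumes eq: "equilibrium a T f z" and z0: "\<And>i. i \<in> S \<Longrightarrow> z i 0 = 0" and i: "i \<in> S"
    and t: "0 \<le> t" "t \<le> T" and pos: "z i t > 0"
  shows "z i t / \<nu> i + a i = level a z t"
proof -
  define p where "p \<theta> = z i \<theta> / \<nu> i + a i - level a z \<theta>" for \<theta>
  define q where "q \<theta> = z i \<theta> / \<nu> i" for \<theta>
  note vi = capacity_pos[OF i]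
  obtain N where N: "negligible N"
    "\<And>\<theta>. 0 < \<theta> \<Longrightarrow> \<theta> \<le> T \<Longrightarrow> \<theta> \<notin> N \<Longrightarrow> balanced a f z \<theta>"
    using equilibrium_balancedE[OF eq] by blast
  \<comment> \<open>This minimum is positive exactly when the link has a queue and lies above the
    level, so increments need to be bounded only at such times.\<close>
  have "min (p t) (q t) \<le> 0"
  proof (rule abs_cont_nonpos_ae[OF _ t(1) N(1), of "\<lambda>\<theta>. min (p \<theta>) (q \<theta>)"])
    obtain C where C: "C-lipschitz_on {0..T} (\<lambda>\<theta>. z i \<theta> / \<nu> i + a i)" "C-lipschitz_on {0..T} (level a z)"
      using equilibrium_lipschitz[OF eq] i by blast
    have "(2 * C)-lipschitz_on {0..T} (\<lambda>\<theta>. min (p \<theta>) (q \<theta>))"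
    proof (rule lipschitz_onI)
      show "0 \<le> 2 * C" using lipschitz_on_nonneg[OF C(1)] by simp
      fix x y assume xy: "x \<in> {0..T}" "y \<in> {0..T}"
      have "\<bar>q x - q y\<bar> \<le> C * \<bar>x - y\<bar>" "\<bar>level a z x - level a z y\<bar> \<le> C * \<bar>x - y\<bar>"
        using lipschitz_onD[OF C(1) xy] lipschitz_onD[OF C(2) xy] by (simp_all add: dist_real_def q_def)
      then show "dist (min (p x) (q x)) (min (p y) (q y)) \<le> 2 * C * dist x y"
        unfolding dist_real_def p_def q_def[symmetric] by linarith
    qed
    then show "abs_cont_on_interval (\<lambda>\<theta>. min (p \<theta>) (q \<theta>)) 0 t"
      by (intro abs_cont_on_interval_subset[OF lipschitz_on_imp_abs_cont_on_interval _ t(2)]) auto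
    show "min (p 0) (q 0) \<le> 0" using z0[OF i] by (simp add: q_def)
    fix x e :: real assume x: "0 < x" "x \<le> t" "x \<notin> N" "min (p x) (q x) > 0" and e: "e > 0"
    have zx: "z i x > 0" using x(4) vi by (simp add: q_def zero_less_divide_iff)
    have "x \<le> T" using x t by simp
    note Nx = N(2)[OF x(1) this x(3)]
    have "f i x = 0" using balanced_minimal[OF Nx i] balanced_flow_nonneg[OF Nx i] x(4) by (force simp: p_def)
    then have "(z i has_real_derivative - \<nu> i) (at x)"
      using balanced_deriv[OF Nx i] zx by (simp add: queue_rate_def)
    then have "(q has_real_derivative - \<nu> i / \<nu> i) (at x)"
      unfolding q_def by (rule DERIV_cdivide)
    then have "(q has_real_derivative - 1) (at x)" using vi by simp
    from has_real_derivative_left_increment_le[OF this order_refl e]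
    obtain d where d: "d > 0" "\<And>h. 0 < h \<Longrightarrow> h < d \<Longrightarrow> q x - q (x - h) \<le> (- 1 + e) * h" by blast
    have "min (p x) (q x) - min (p (x - h)) (q (x - h)) \<le> e * h"
      if h: "0 < h" "h < d" "0 \<le> x - h" for h
    proof -
      have 1: "q x - q (x - h) \<le> - h + e * h" using d(2)[OF h(1,2)] by (simp add: algebra_simps)
      \<comment> \<open>A link attaining the level at the later time \<open>x\<close> shows that the
        level at \<open>x - h\<close> is at most \<open>h\<close> higher.\<close>
      obtain j where j: "j \<in> S" "level a z x = z j x / \<nu> j + a j" using level_attained by blast
      have "x - h + z j (x - h) / \<nu> j \<le> x + z j x / \<nu> j"
        using equilibrium_link_time_mono[OF eq j(1), of "x - h" x] h \<open>x \<le> T\<close> by simp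
      then have "level a z (x - h) - h \<le> level a z x" using j level_le[OF j(1), of a z "x - h"] by simp
      then show ?thesis using 1 h(1) unfolding p_def q_def[symmetric] by linarith
    qed
    then show "\<exists>d>0. \<forall>h. 0 < h \<and> h < d \<and> 0 \<le> x - h \<longrightarrow>
       min (p x) (q x) - min (p (x - h)) (q (x - h)) \<le> e * h" using d(1) by blast
  qed
  moreover have "q t > 0" using pos vi by (simp add: q_def)
  ultimately have "p t \<le> 0" by linarith
  then show ?thesis using level_le[OF i, of a z t] by (simp add: p_def)
qed

text \<open>While the level for the smaller travel times exceeds the other one, every link carrying flow
  in the second equilibrium has a positive queue in the first. One of these links receives at
  least as much flow in the second equilibrium as in the first, so its queue grows at least as fast
  there.\<close>

lemma level_mono_travel_times:
  assumes eqa: "equilibrium a T f z" and z0: "\<And>i. i \<in> S \<Longrightarrow> z i 0 = 0"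
    and eqb: "equilibrium b T g y" and T: "0 \<le> T"
    and ab: "\<And>i. i \<in> S \<Longrightarrow> a i \<le> b i" and init: "level a z 0 \<le> level b y 0"
  shows "level a z T \<le> level b y T"
proof -
  obtain N where N: "negligible N"
    "\<And>\<theta>. 0 < \<theta> \<Longrightarrow> \<theta> \<le> T \<Longrightarrow> \<theta> \<notin> N \<Longrightarrow> balanced a f z \<theta>"
    using equilibrium_balancedE[OF eqa] by blast
  obtain N' where N': "negligible N'"
    "\<And>\<theta>. 0 < \<theta> \<Longrightarrow> \<theta> \<le> T \<Longrightarrow> \<theta> \<notin> N' \<Longrightarrow> balanced b g y \<theta>"
    using equilibrium_balancedE[OF eqb] by blast
  define p where "p \<theta> = level a z \<theta> - level b y \<theta>" for \<theta>
  have "p T \<le> 0"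
  proof (rule abs_cont_nonpos_ae[OF _ T negligible_Un[OF N(1) N'(1)]])
    obtain C D where CD: "C-lipschitz_on {0..T} (level a z)" "D-lipschitz_on {0..T} (level b y)"
      using equilibrium_lipschitz[OF eqa] equilibrium_lipschitz[OF eqb] by blast
    have "(C + D)-lipschitz_on {0..T} p"
      unfolding p_def using CD by (rule lipschitz_on_diff)
    then show "abs_cont_on_interval p 0 T" by (rule lipschitz_on_imp_abs_cont_on_interval)
    show "p 0 \<le> 0" using init by (simp add: p_def)
    fix x e :: real assume x: "0 < x" "x \<le> T" "x \<notin> N \<union> N'" "p x > 0" and e: "e > 0"
    have "x \<notin> N" "x \<notin> N'" using x(3) by auto
    note Nx = N(2)[OF x(1,2) this(1)] and Nx' = N'(2)[OF x(1,2) this(2)]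
    \<comment> \<open>Both flows sum to \<open>u > 0\<close>. If \<open>f\<close> exceeded
      \<open>g\<close> on every link used by \<open>g\<close>, the total of \<open>f\<close> would
      be larger.\<close>
    have "\<exists>i\<in>S. 0 < g i x \<and> f i x \<le> g i x"
    proof (rule ccontr)
      assume no: "\<not> (\<exists>i\<in>S. 0 < g i x \<and> f i x \<le> g i x)"
      have "(\<Sum>i\<in>S. g i x) < (\<Sum>i\<in>S. f i x)"
      proof (rule sum_strict_mono_ex1[OF finite_links])
        show "\<forall>i\<in>S. g i x \<le> f i x"
          using no balanced_flow_nonneg[OF Nx] by (meson less_imp_le not_less order_trans)
        have "\<exists>i\<in>S. g i x > 0"
        proof (rule ccontr)
          assume "\<not> (\<exists>i\<in>S. g i x > 0)"
          then have "(\<Sum>i\<in>S. g i x) \<le> 0" by (intro sum_nonpos) (auto simp: not_less)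
          then show False using balanced_sum[OF Nx'] inflow_pos by simp
        qed
        then show "\<exists>i\<in>S. g i x < f i x" using no by force
      qed
      then show False using balanced_sum[OF Nx] balanced_sum[OF Nx'] by simp
    qed
    then obtain i where i: "i \<in> S" "0 < g i x" "f i x \<le> g i x" by blast
    note vi = capacity_pos[OF i(1)]
    have lb: "level b y x = y i x / \<nu> i + b i" using balanced_minimal[OF Nx' i(1,2)] by simp
    have yx: "0 \<le> y i x" using equilibrium_nonneg[OF eqb i(1)] x by simp
    \<comment> \<open>The first level exceeds the second, which is at least \<open>b i\<close> and
      hence at least \<open>a i\<close> on this link; only a queue can make up the
      difference.\<close>
    have "0 < z i x / \<nu> i"
      using x(4) lb level_le[OF i(1), of a z x] ab[OF i(1)] divide_nonneg_pos[OF yx vi]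
      by (simp add: p_def)
    then have zx: "z i x > 0" using vi by (simp add: zero_less_divide_iff)
    have dz: "(z i has_real_derivative f i x - \<nu> i) (at x)"
      using balanced_deriv[OF Nx i(1)] zx by (simp add: queue_rate_def)
    have dy: "(y i has_real_derivative queue_rate g y i x) (at x)"
      using balanced_deriv[OF Nx' i(1)] .
    define w where "w \<theta> = (z i \<theta> - y i \<theta>) / \<nu> i" for \<theta>
    have "(w has_real_derivative ((f i x - \<nu> i) - queue_rate g y i x) / \<nu> i) (at x)"
      unfolding w_def by (intro DERIV_cdivide DERIV_diff dz dy)
    moreover have "((f i x - \<nu> i) - queue_rate g y i x) / \<nu> i \<le> 0"
      using i(3) ge_queue_rate[of g i x y] vi by (simp add: divide_le_0_iff)
    ultimately obtain d where d: "d > 0" "\<And>h. 0 < h \<Longrightarrow> h < d \<Longrightarrow> w x - w (x - h) \<le> (0 + e) * h"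
      using has_real_derivative_left_increment_le e by meson
    \<comment> \<open>The queue is still positive shortly before \<open>x\<close>, so link
      \<open>i\<close> attains the first level at \<open>x - h\<close>, while it attains the second
      at \<open>x\<close>. At the opposite ends the level is only bounded by the delay on
      \<open>i\<close>, in the direction that makes the increment of \<open>p\<close> at most that
      of \<open>w\<close>.\<close>
    have "isCont (z i) x" using dz by (rule DERIV_isCont)
    then obtain d' where d': "d' > 0" "\<And>t. dist t x < d' \<Longrightarrow> dist (z i t) (z i x) < z i x"
      using zx unfolding continuous_at_eps_delta by (auto simp: dist_real_def)
    have "p x - p (x - h) \<le> e * h" if h: "0 < h" "h < min d d'" "0 \<le> x - h" for h
    proof -
      have "dist (z i (x - h)) (z i x) < z i x" using h by (intro d'(2)) (auto simp: dist_real_def)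
      then have "z i (x - h) > 0" by (auto simp: dist_real_def)
      then have la: "z i (x - h) / \<nu> i + a i = level a z (x - h)"
        using h x by (intro equilibrium_positive_queue_minimal[OF eqa z0 i(1)]) auto
      have "w x - w (x - h) \<le> e * h" using d(2) h by auto
      then have "(z i x / \<nu> i - y i x / \<nu> i) - (z i (x - h) / \<nu> i - y i (x - h) / \<nu> i) \<le> e * h"
        by (simp add: w_def diff_divide_distrib)
      then show ?thesis
        unfolding p_def using la lb level_le[OF i(1), of a z x] level_le[OF i(1), of b y "x - h"] by linarith
    qed
    then show "\<exists>d>0. \<forall>h. 0 < h \<and> h < d \<and> 0 \<le> x - h \<longrightarrow> p x - p (x - h) \<le> e * h"
      using d(1) d'(1) by (intro exI[of _ "min d d'"]) auto
  qed
  then show ?thesis by (simp add: p_def)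
qed

text \<open>Compare the equilibrium with its own time shift, which starts at a level that is at least the
  initial one.\<close>

lemma level_mono_time:
  assumes eq: "equilibrium a T f z" and z0: "\<And>i. i \<in> S \<Longrightarrow> z i 0 = 0"
    and st: "0 \<le> s" "s \<le> t" "t \<le> T"
  shows "level a z s \<le> level a z t"
proof -
  let ?r = "t - s"
  have "level a z s \<le> level a (\<lambda>i \<theta>. z i (\<theta> + ?r)) s"
  proof (rule level_mono_travel_times)
    show "equilibrium a s f z" using st by (intro equilibrium_restrict[OF eq]) auto
    show "equilibrium a s (\<lambda>i \<theta>. f i (\<theta> + ?r)) (\<lambda>i \<theta>. z i (\<theta> + ?r))"
      using st by (intro equilibrium_restrict[OF equilibrium_shift[OF eq, of ?r]]) auto
    show "level a z 0 \<le> level a (\<lambda>i \<theta>. z i (\<theta> + ?r)) 0"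
    proof (rule level_geI)
      fix i assume i: "i \<in> S"
      have "0 \<le> z i ?r" using equilibrium_nonneg[OF eq i] st by auto
      then have "0 \<le> z i ?r / \<nu> i" using capacity_pos[OF i] by simp
      then show "level a z 0 \<le> z i (0 + ?r) / \<nu> i + a i"
        using level_le[OF i, of a z 0] z0[OF i] by simp
    qed
  qed (use st z0 in auto)
  then show ?thesis by (simp add: level_def)
qed

text \<open>Links with \<open>b i > level b y T\<close> carry no flow before \<open>T\<close>, so truncating \<open>b\<close> at this level
  does not affect the equilibrium; the truncated travel times dominate \<open>a\<close> up to the constant
  \<open>V - level b y T\<close>.\<close>

lemma equilibrium_delay_le:
  assumes eqa: "equilibrium a T f z" and z0: "\<And>i. i \<in> S \<Longrightarrow> z i 0 = 0"
    and eqb: "equilibrium b T g y" and y0: "\<And>i. i \<in> S \<Longrightarrow> y i 0 = 0" and T: "0 \<le> T"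
    and V: "\<And>i. i \<in> S \<Longrightarrow> y i T / \<nu> i + a i \<le> V" and i: "i \<in> S"
  shows "z i T / \<nu> i + a i \<le> V"
proof -
  define l where "l = level b y T"
  define b' where "b' i = min (b i) l + (V - l)" for i
  have ynn: "0 \<le> y i \<theta> / \<nu> i" if "i \<in> S" "0 \<le> \<theta>" "\<theta> \<le> T" for i \<theta>
    using equilibrium_nonneg[OF eqb that] capacity_pos[OF that(1)] by simp
  \<comment> \<open>No level before \<open>T\<close> exceeds the final one \<open>l\<close>, and
    queues are nonnegative, so cutting travel times down to \<open>l\<close> pushes no link below
    the minimum.\<close>
  have lev: "level b' y \<theta> = level b y \<theta> + (V - l)" if \<theta>: "0 \<le> \<theta>" "\<theta> \<le> T" for \<theta>
  proof (rule antisym)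
    have le: "level b y \<theta> \<le> l" unfolding l_def using eqb y0 \<theta> by (intro level_mono_time) auto
    obtain j where j: "j \<in> S" "level b y \<theta> = y j \<theta> / \<nu> j + b j" using level_attained by blast
    show "level b' y \<theta> \<le> level b y \<theta> + (V - l)"
      using level_le[OF j(1), of b' y \<theta>] j by (auto simp: b'_def)
    show "level b y \<theta> + (V - l) \<le> level b' y \<theta>"
    proof (rule level_geI)
      fix k assume k: "k \<in> S"
      show "level b y \<theta> + (V - l) \<le> y k \<theta> / \<nu> k + b' k"
        using level_le[OF k, of b y \<theta>] ynn[OF k \<theta>] le by (auto simp: b'_def)
    qed
  qed
  have eqb': "equilibrium b' T g y"
  proof -
    have "y i \<theta> / \<nu> i + b' i = level b' y \<theta>"
      if "i \<in> S" "0 < \<theta>" "\<theta> \<le> T" "y i \<theta> / \<nu> i + b i = level b y \<theta>" for i \<theta>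
    proof -
      have "level b y \<theta> \<le> l" unfolding l_def using eqb y0 that by (intro level_mono_time) auto
      then have "b i \<le> l" using that(4) ynn[OF that(1), of \<theta>] that by simp
      then show ?thesis using lev[of \<theta>] that by (simp add: b'_def)
    qed
    then have "balanced b' g y \<theta>" if "0 < \<theta>" "\<theta> \<le> T" "balanced b g y \<theta>" for \<theta>
      using that unfolding balanced_def by blast
    then show ?thesis using eqb unfolding equilibrium_def by meson
  qed
  \<comment> \<open>If \<open>b i \<ge> l\<close>, then \<open>b' i = V\<close>, and
    \<open>a i \<le> V\<close> because the queue is nonnegative. Otherwise the delay on
    \<open>i\<close> at \<open>T\<close> is at least \<open>l\<close>, so the wait is at least
    \<open>l - b i\<close> and the bound \<open>V\<close> leaves at most
    \<open>b i + (V - l)\<close> for \<open>a i\<close>.\<close>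
  have ab: "a i \<le> b' i" if i: "i \<in> S" for i
    using V[OF i] level_le[OF i, of b y T] ynn[OF i T order_refl] by (auto simp: b'_def l_def)
  have "level a z T \<le> level b' y T"
  proof (rule level_mono_travel_times[OF eqa z0 eqb' T ab])
    show "level a z 0 \<le> level b' y 0"
    proof (rule level_geI)
      fix i assume i: "i \<in> S"
      show "level a z 0 \<le> y i 0 / \<nu> i + b' i"
        using level_le[OF i, of a z 0] z0[OF i] y0[OF i] ab[OF i] by simp
    qed
  qed
  also have "\<dots> = V" using lev[of T] T by (simp add: l_def)
  finally have lV: "level a z T \<le> V" .
  \<comment> \<open>The level controls only links with a queue; on the others the delay is
    \<open>a i\<close>, which is bounded directly by \<open>V\<close>.\<close>
  show ?thesis
  proof (cases "z i T > 0")
    case True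
    then show ?thesis using equilibrium_positive_queue_minimal[OF eqa z0 i T order_refl] lV by simp
  next
    case False
    moreover have "0 \<le> z i T" using equilibrium_nonneg[OF eqa i] T by simp
    ultimately show ?thesis using V[OF i] ynn[OF i T order_refl] by simp
  qed
qed

end

section \<open>Regularity of queues from the almost-everywhere conditions\<close>

lemma AE_lborel_imp_negligible:
  assumes "AE x in lborel. P (x::real)"
  shows "\<exists>N. negligible N \<and> (\<forall>x. x \<notin> N \<longrightarrow> P x)"
proof -
  from AE_E[OF assms] obtain N where N: "{x \<in> space lborel. \<not> P x} \<subseteq> N" "emeasure lborel N = 0" "N \<in> sets lborel"
    by auto
  then have "negligible N" by (simp add: negligible_iff_null_sets null_sets_completionI null_sets_def)
  then show ?thesis using N(1) by auto
qed

context parallel_links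
begin

text \<open>A negative queue has nonnegative rate, so queues starting at 0 never become negative.
  Total inflow and capacities bound the rates, which upgrades absolute continuity to a Lipschitz
  bound.\<close>

lemma equilibriumI:
  assumes ac: "\<And>i b. i \<in> S \<Longrightarrow> 0 \<le> b \<Longrightarrow> abs_cont_on_interval (z i) 0 b"
    and z0: "\<And>i. i \<in> S \<Longrightarrow> z i 0 = 0"
    and N: "negligible N" "\<And>\<theta>. 0 < \<theta> \<Longrightarrow> \<theta> \<notin> N \<Longrightarrow> balanced a f z \<theta>"
  shows "equilibrium a T f z"
proof -
  have nonneg: "0 \<le> z i t" if i: "i \<in> S" and t: "0 \<le> t" for i t
  proof -
    have "- z i t \<le> 0"
    proof (rule abs_cont_nonpos_ae[OF abs_cont_on_interval_uminus[OF ac[OF i t]] t N(1)])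
      fix x e :: real assume x: "0 < x" "x \<le> t" "x \<notin> N" "- z i x > 0" "e > 0"
      have "((\<lambda>x. - z i x) has_real_derivative - queue_rate f z i x) (at x)"
        using balanced_deriv[OF N(2)[OF x(1,3)] i] by (rule DERIV_minus)
      moreover have "- queue_rate f z i x \<le> 0" using x(4) by (simp add: queue_rate_def)
      ultimately have "\<exists>d>0. \<forall>h. 0 < h \<and> h < d \<longrightarrow> - z i x - - z i (x - h) \<le> (0 + e) * h"
        using x(5) by (rule has_real_derivative_left_increment_le)
      then show "\<exists>d>0. \<forall>h. 0 < h \<and> h < d \<and> 0 \<le> x - h \<longrightarrow> - z i x - - z i (x - h) \<le> e * h"
        by auto
    qed (simp add: z0[OF i])
    then show ?thesis by simp
  qed
  \<comment> \<open>Dominates both the fastest growth, at most \<open>u\<close>, and the fastest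
    drain, at most \<open>\<nu> i\<close>.\<close>
  define C where "C = u + (\<Sum>i\<in>S. \<nu> i)"
  have \<nu>C: "\<nu> i \<le> C" if "i \<in> S" for i
  proof -
    have "\<nu> i \<le> (\<Sum>i\<in>S. \<nu> i)"
      using that finite_links capacity_pos by (intro member_le_sum) (auto simp: less_imp_le)
    then show ?thesis using inflow_pos by (simp add: C_def)
  qed
  have "0 \<le> (\<Sum>i\<in>S. \<nu> i)" using capacity_pos by (intro sum_nonneg) (simp add: less_imp_le)
  then have uC: "u \<le> C" by (simp add: C_def)
  have lip: "\<bar>z i x - z i y\<bar> \<le> C * (y - x)" if i: "i \<in> S" and xy: "0 \<le> x" "x \<le> y" for i x y
  proof -
    have acxy: "abs_cont_on_interval (z i) x y"
      using ac[OF i, of y] xy by (auto intro: abs_cont_on_interval_subset)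
    have "z i y - z i x \<le> C * (y - x)"
    proof (rule abs_cont_growth_le[OF acxy xy(2) N(1)])
      fix \<theta> assume "x < \<theta>" "\<theta> \<le> y" "\<theta> \<notin> N"
      then have b: "balanced a f z \<theta>" using N(2) xy by simp
      have "f i \<theta> \<le> u"
        using member_le_sum[OF i, of "\<lambda>i. f i \<theta>"] balanced_flow_nonneg[OF b] balanced_sum[OF b]
          finite_links by simp
      then have "queue_rate f z i \<theta> \<le> C"
        using capacity_pos[OF i] uC inflow_pos by (auto simp: queue_rate_def)
      then show "\<exists>D\<le>C. (z i has_real_derivative D) (at \<theta>)" using balanced_deriv[OF b i] by blast
    qed
    moreover have "- z i y - - z i x \<le> C * (y - x)"
    proof (rule abs_cont_growth_le[OF abs_cont_on_interval_uminus[OF acxy] xy(2) N(1)])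
      fix \<theta> assume "x < \<theta>" "\<theta> \<le> y" "\<theta> \<notin> N"
      then have b: "balanced a f z \<theta>" using N(2) xy by simp
      have "- queue_rate f z i \<theta> \<le> C"
        using ge_queue_rate[of f i \<theta> z] balanced_flow_nonneg[OF b i] \<nu>C[OF i] by simp
      then show "\<exists>D\<le>C. ((\<lambda>x. - z i x) has_real_derivative D) (at \<theta>)"
        using DERIV_minus[OF balanced_deriv[OF b i]] by blast
    qed
    ultimately show ?thesis by simp
  qed
  have "C-lipschitz_on {0..T} (z i)" if i: "i \<in> S" for i
  proof (rule lipschitz_onI)
    show "0 \<le> C" using uC inflow_pos by simp
    fix x y assume xy: "x \<in> {0..T}" "y \<in> {0..T}"
    show "dist (z i x) (z i y) \<le> C * dist x y"
    proof (cases "x \<le> y")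
      case True
      then show ?thesis using lip[OF i, of x y] xy by (simp add: dist_real_def)
    next
      case False
      then show ?thesis using lip[OF i, of y x] xy by (simp add: dist_real_def abs_minus_commute)
    qed
  qed
  then show ?thesis
    unfolding equilibrium_def using nonneg N by auto
qed

end

subsection \<open>Existence of equilibria by water filling\<close>

text \<open>The queue of link \<open>i\<close> is \<open>\<nu> i * max (L - a i) 0\<close> for a common level \<open>L\<close>.\<close>

definition water_filling ::
  "'i set \<Rightarrow> ('i \<Rightarrow> real) \<Rightarrow> real \<Rightarrow> ('i \<Rightarrow> real) \<Rightarrow> (real \<Rightarrow> real) \<Rightarrow> ('i \<Rightarrow> real \<Rightarrow> real) \<Rightarrow> bool" where
  "water_filling S \<nu> u a L f \<longleftrightarrow>
     (\<exists>C\<ge>0. \<forall>x\<ge>0. \<forall>y\<ge>x. L x \<le> L y \<and> L y - L x \<le> C * (y - x)) \<and>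
     (\<forall>i\<in>S. L 0 \<le> a i) \<and>
     (u \<le> sum \<nu> S \<longrightarrow> (\<forall>x\<ge>0. \<exists>i\<in>S. L x \<le> a i)) \<and>
     (\<forall>i\<in>S. f i \<in> borel_measurable borel \<and> (\<forall>x. 0 \<le> f i x) \<and> (\<forall>x\<ge>0. f i x > 0 \<longrightarrow> a i \<le> L x)) \<and>
     (\<forall>x\<ge>0. (\<Sum>i\<in>S. f i x) = u) \<and>
     (\<exists>N. finite N \<and> (\<forall>x>0. x \<notin> N \<longrightarrow> (\<forall>i\<in>S. ((\<lambda>x. \<nu> i * max (L x - a i) 0) has_real_derivative
        (if \<nu> i * max (L x - a i) 0 > 0 then f i x - \<nu> i else max (f i x - \<nu> i) 0)) (at x))))"

lemma water_fillingE:
  assumes "water_filling S \<nu> u a L f"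
  obtains C N where "C \<ge> 0"
    "\<And>x y. 0 \<le> x \<Longrightarrow> x \<le> y \<Longrightarrow> L x \<le> L y"
    "\<And>x y. 0 \<le> x \<Longrightarrow> x \<le> y \<Longrightarrow> L y - L x \<le> C * (y - x)"
    "\<And>i. i \<in> S \<Longrightarrow> L 0 \<le> a i"
    "u \<le> sum \<nu> S \<Longrightarrow> \<forall>x\<ge>0. \<exists>i\<in>S. L x \<le> a i"
    "\<And>i. i \<in> S \<Longrightarrow> f i \<in> borel_measurable borel"
    "\<And>i x. i \<in> S \<Longrightarrow> 0 \<le> f i x"
    "\<And>i x. i \<in> S \<Longrightarrow> x \<ge> 0 \<Longrightarrow> f i x > 0 \<Longrightarrow> a i \<le> L x"
    "\<And>x. x \<ge> 0 \<Longrightarrow> (\<Sum>i\<in>S. f i x) = u"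
    "finite N"
    "\<And>x i. x > 0 \<Longrightarrow> x \<notin> N \<Longrightarrow> i \<in> S \<Longrightarrow>
      ((\<lambda>x. \<nu> i * max (L x - a i) 0) has_real_derivative
        (if \<nu> i * max (L x - a i) 0 > 0 then f i x - \<nu> i else max (f i x - \<nu> i) 0)) (at x)"
proof -
  obtain C where C: "C \<ge> 0" "\<forall>x\<ge>0. \<forall>y\<ge>x. L x \<le> L y \<and> L y - L x \<le> C * (y - x)"
    using assms unfolding water_filling_def by (elim conjE exE)
  obtain N where N: "finite N" "\<forall>x>0. x \<notin> N \<longrightarrow> (\<forall>i\<in>S. ((\<lambda>x. \<nu> i * max (L x - a i) 0) has_real_derivative
        (if \<nu> i * max (L x - a i) 0 > 0 then f i x - \<nu> i else max (f i x - \<nu> i) 0)) (at x))"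
    using assms unfolding water_filling_def by (elim conjE exE)
  show thesis
    using assms unfolding water_filling_def
    by (intro that[OF C(1) C(2)[rule_format, THEN conjunct1] C(2)[rule_format, THEN conjunct2] _ _ _ _ _ _ N(1)
          N(2)[rule_format]]) simp_all
qed

lemma has_real_derivative_cong_open:
  assumes "(g has_real_derivative D) (at x)" "open U" "x \<in> U" "\<And>y. y \<in> U \<Longrightarrow> f y = g y"
  shows "(f has_real_derivative D) (at x)"
  using has_field_derivative_transform_within_open[OF assms(1-3)] assms(4) by metis

text \<open>Links are added in order of travel time, so the new link \<open>k\<close> has the
  largest one so far. A solution for the old links remains valid up to a time \<open>t\<close> with
  \<open>L t = a k\<close>; from there on constant flows and a linear level continue it. If the
  level never exceeds \<open>a k\<close>, the new link stays idle.\<close>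

lemma water_filling_exists:
  fixes a \<nu> :: "'i \<Rightarrow> real"
  assumes "finite S" "S \<noteq> {}" "\<And>i. i \<in> S \<Longrightarrow> \<nu> i > 0" "u > 0"
  shows "\<exists>L f. water_filling S \<nu> u a L f"
  using assms(1) assms(2,3)
proof (induction S rule: finite_ranking_induct[where f = a])
  case empty
  then show ?case by simp
next
  case (insert k S)
  have vk: "\<nu> k > 0" using insert.prems by simp
  \<comment> \<open>The empty case is vacuous, so a single link is the real base case; the ranking
    induction also allows \<open>k\<close> to be in \<open>S\<close> already.\<close>
  consider "S = {}" | "k \<in> S" | "S \<noteq> {}" "k \<notin> S" by blast
  then show ?case
  proof cases
    case 1
    \<comment> \<open>Chosen so that \<open>\<nu> k * r\<close> is the excess of inflow over
      capacity, if there is any.\<close>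
    define r where "r = max (u / \<nu> k - 1) 0"
    have r0: "r \<ge> 0" by (simp add: r_def)
    define L where "L x = a k + r * x" for x
    have "water_filling {k} \<nu> u a L (\<lambda>_ _. u)"
      unfolding water_filling_def
    proof (intro conjI)
      show "\<exists>C\<ge>0. \<forall>x\<ge>0. \<forall>y\<ge>x. L x \<le> L y \<and> L y - L x \<le> C * (y - x)"
        using r0 by (intro exI[of _ r]) (auto simp: L_def right_diff_distrib mult_left_mono)
      show "u \<le> sum \<nu> {k} \<longrightarrow> (\<forall>x\<ge>0. \<exists>i\<in>{k}. L x \<le> a i)"
        using vk by (auto simp: L_def r_def max_def field_simps)
      show "\<forall>i\<in>{k}. (\<lambda>_. u) \<in> borel_measurable borel \<and> (\<forall>x. 0 \<le> u) \<and> (\<forall>x\<ge>0. u > 0 \<longrightarrow> a i \<le> L x)"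
        using assms(4) r0 by (auto simp: L_def)
      have "((\<lambda>x. \<nu> k * max (L x - a k) 0) has_real_derivative
        (if \<nu> k * max (L x - a k) 0 > 0 then u - \<nu> k else max (u - \<nu> k) 0)) (at x)" if x: "x > 0" for x
      proof (rule has_real_derivative_cong_open[of "\<lambda>x. \<nu> k * r * x" _ _ "{0<..}"])
        have "\<nu> k * r = max (u - \<nu> k) 0"
          using vk by (auto simp: r_def max_def field_simps)
        moreover have "\<nu> k * max (L x - a k) 0 > 0 \<longrightarrow> r > 0"
          using x vk r0 by (cases "r = 0") (auto simp: L_def)
        moreover have "r > 0 \<longrightarrow> max (u - \<nu> k) 0 = u - \<nu> k"
          using vk by (auto simp: r_def max_def field_simps split: if_splits)
        ultimately have "(if \<nu> k * max (L x - a k) 0 > 0 then u - \<nu> k else max (u - \<nu> k) 0) = \<nu> k * r"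
          by auto
        then show "((\<lambda>x. \<nu> k * r * x) has_real_derivative
          (if \<nu> k * max (L x - a k) 0 > 0 then u - \<nu> k else max (u - \<nu> k) 0)) (at x)"
          by (auto intro!: derivative_eq_intros)
      qed (use x r0 in \<open>auto simp: L_def max_absorb1\<close>)
      then show "\<exists>N. finite N \<and> (\<forall>x>0. x \<notin> N \<longrightarrow> (\<forall>i\<in>{k}. ((\<lambda>x. \<nu> i * max (L x - a i) 0) has_real_derivative
        (if \<nu> i * max (L x - a i) 0 > 0 then u - \<nu> i else max (u - \<nu> i) 0)) (at x)))"
        by (intro exI[of _ "{}"]) auto
    qed (auto simp: L_def)
    then show ?thesis using 1 by blast
  next
    case 2
    then show ?thesis using insert.IH insert.prems by (auto simp: insert_absorb)
  next
    case 3
    obtain L f where wf: "water_filling S \<nu> u a L f" using insert 3 by auto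
    obtain C N where C: "C \<ge> 0" "\<And>x y. 0 \<le> x \<Longrightarrow> x \<le> y \<Longrightarrow> L x \<le> L y"
      "\<And>x y. 0 \<le> x \<Longrightarrow> x \<le> y \<Longrightarrow> L y - L x \<le> C * (y - x)"
      and L0: "\<And>i. i \<in> S \<Longrightarrow> L 0 \<le> a i"
      and Lsat: "u \<le> sum \<nu> S \<Longrightarrow> \<forall>x\<ge>0. \<exists>i\<in>S. L x \<le> a i"
      and fm: "\<And>i. i \<in> S \<Longrightarrow> f i \<in> borel_measurable borel"
      and f0: "\<And>i x. i \<in> S \<Longrightarrow> 0 \<le> f i x"
      and fL: "\<And>i x. i \<in> S \<Longrightarrow> x \<ge> 0 \<Longrightarrow> f i x > 0 \<Longrightarrow> a i \<le> L x"
      and fsum: "\<And>x. x \<ge> 0 \<Longrightarrow> (\<Sum>i\<in>S. f i x) = u"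
      and N: "finite N" "\<And>x i. x > 0 \<Longrightarrow> x \<notin> N \<Longrightarrow> i \<in> S \<Longrightarrow>
        ((\<lambda>x. \<nu> i * max (L x - a i) 0) has_real_derivative
        (if \<nu> i * max (L x - a i) 0 > 0 then f i x - \<nu> i else max (f i x - \<nu> i) 0)) (at x)"
      by (rule water_fillingE[OF wf]) (rule that)
    have ak: "a i \<le> a k" if "i \<in> S" for i using insert.hyps(2)[OF that] .
    have L0k: "L 0 \<le> a k" using L0 ak 3(1) by force
    show ?thesis
    proof (cases "\<forall>x\<ge>0. L x \<le> a k")
      case True
      define f' where "f' i x = (if i = k then 0 else f i x)" for i x
      have "water_filling (insert k S) \<nu> u a L f'"
        unfolding water_filling_def
      proof (intro conjI)
        show "\<exists>C\<ge>0. \<forall>x\<ge>0. \<forall>y\<ge>x. L x \<le> L y \<and> L y - L x \<le> C * (y - x)" using C by blast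
        show "\<forall>i\<in>insert k S. L 0 \<le> a i" using L0 L0k by auto
        show "u \<le> sum \<nu> (insert k S) \<longrightarrow> (\<forall>x\<ge>0. \<exists>i\<in>insert k S. L x \<le> a i)" using True by auto
        show "\<forall>i\<in>insert k S. f' i \<in> borel_measurable borel \<and> (\<forall>x. 0 \<le> f' i x) \<and>
            (\<forall>x\<ge>0. f' i x > 0 \<longrightarrow> a i \<le> L x)"
          using fm f0 fL by (auto simp: f'_def[abs_def])
        have "(\<Sum>i\<in>S. f' i x) = (\<Sum>i\<in>S. f i x)" for x
          using 3(2) by (intro sum.cong) (auto simp: f'_def)
        then show "\<forall>x\<ge>0. (\<Sum>i\<in>insert k S. f' i x) = u"
          using 3(2) insert.hyps(1) fsum by (simp add: f'_def)
        have "((\<lambda>x. \<nu> i * max (L x - a i) 0) has_real_derivative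
          (if \<nu> i * max (L x - a i) 0 > 0 then f' i x - \<nu> i else max (f' i x - \<nu> i) 0)) (at x)"
          if x: "x > 0" "x \<notin> N" "i \<in> insert k S" for x i
        proof (cases "i = k")
          case True
          have "((\<lambda>x. \<nu> k * max (L x - a k) 0) has_real_derivative 0) (at x)"
            by (rule has_real_derivative_cong_open[of "\<lambda>_. 0" _ _ "{0<..}"])
              (use x \<open>\<forall>x\<ge>0. L x \<le> a k\<close> in auto)
          then show ?thesis
            using True \<open>\<forall>x\<ge>0. L x \<le> a k\<close> x(1) vk by (simp add: f'_def max_def)
        next
          case False
          then have "i \<in> S" "f' i x = f i x" using x by (auto simp: f'_def)
          then show ?thesis using N(2)[OF x(1,2)] by (simp only:)
        qed
        then show "\<exists>N. finite N \<and> (\<forall>x>0. x \<notin> N \<longrightarrow> (\<forall>i\<in>insert k S.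
          ((\<lambda>x. \<nu> i * max (L x - a i) 0) has_real_derivative
          (if \<nu> i * max (L x - a i) 0 > 0 then f' i x - \<nu> i else max (f' i x - \<nu> i) 0)) (at x)))"
          using N(1) by (intro exI[of _ N]) blast
      qed
      then show ?thesis by blast
    next
      case False
      then obtain x1 where x1: "x1 \<ge> 0" "L x1 > a k" by (auto simp: not_le)
      \<comment> \<open>The saturation clause of \<open>water_filling\<close> is used here: the
        level rises above all travel times in \<open>S\<close> only if the old capacities are
        exceeded. So a positive remainder is left for \<open>k\<close>.\<close>
      have unsat: "sum \<nu> S < u"
        using Lsat x1 ak by (meson leI less_le_trans not_less order_trans)
      have "continuous_on {0..x1} L"
      proof -
        have "C-lipschitz_on {0..x1} L"
        proof (rule lipschitz_onI[OF _ C(1)])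
          fix x y assume "x \<in> {0..x1}" "y \<in> {0..x1}"
          then show "dist (L x) (L y) \<le> C * dist x y"
            using C(2,3)[of x y] C(2,3)[of y x] by (cases "x \<le> y") (auto simp: dist_real_def abs_if)
        qed
        then show ?thesis by (rule lipschitz_on_continuous_on)
      qed
      then obtain t where t: "0 \<le> t" "L t = a k"
        using IVT'[of L 0 "a k" x1] L0k x1 by auto
      define W where "W = sum \<nu> S + \<nu> k"
      have "sum \<nu> S > 0" using insert.prems insert.hyps(1) 3(1) by (intro sum_pos) auto
      then have W: "W > 0" using vk by (simp add: W_def)
      define c where "c = max (u / W - 1) 0"
      have c0: "c \<ge> 0" by (simp add: c_def)
      \<comment> \<open>If even \<open>W\<close> is too small, splitting in proportion to capacity
        lets all waiting times grow at the common rate \<open>u / W - 1\<close>. Otherwise the old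
        links run exactly at capacity, \<open>k\<close> absorbs the remainder, and the level rests
        at \<open>a k\<close>.\<close>
      define g where "g i = (if W < u then \<nu> i * (u / W) else if i = k then u - sum \<nu> S else \<nu> i)" for i
      define L' where "L' x = (if x \<le> t then L x else a k + c * (x - t))" for x
      define f' where "f' i x = (if x \<le> t then if i = k then 0 else f i x else g i)" for i x
      have g0: "0 \<le> g i" if "i \<in> insert k S" for i
        using insert.prems(2)[OF that] unsat W assms(4) by (auto simp: g_def)
      have gsum: "sum g (insert k S) = u"
      proof (cases "W < u")
        case True
        then have "sum g (insert k S) = (\<Sum>i\<in>insert k S. \<nu> i * (u / W))"
          by (intro sum.cong) (simp_all add: g_def)
        also have "\<dots> = sum \<nu> (insert k S) * (u / W)" by (rule sum_distrib_right[symmetric])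
        also have "sum \<nu> (insert k S) = W" using 3(2) insert.hyps(1) by (simp add: W_def)
        finally show ?thesis using W by simp
      next
        case False
        have "sum g S = sum \<nu> S" using False 3(2) by (intro sum.cong) (auto simp: g_def)
        then show ?thesis using False 3(2) insert.hyps(1) by (simp add: g_def)
      qed
      have Lt: "L x \<le> a k" if "0 \<le> x" "x \<le> t" for x using C(2)[OF that] t by simp
      have ak': "a i \<le> a k" if "i \<in> insert k S" for i using ak that by auto
      have "water_filling (insert k S) \<nu> u a L' f'"
        unfolding water_filling_def
      proof (intro conjI)
        have "L' x \<le> L' y \<and> L' y - L' x \<le> (C + c) * (y - x)" if xy: "0 \<le> x" "x \<le> y" for x y
        proof -
          consider "y \<le> t" | "x \<le> t" "t < y" | "t < x" using xy by linarith
          then show ?thesis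
          proof cases
            case 1
            have "0 \<le> c * (y - x)" using c0 xy by simp
            then show ?thesis using 1 C(2,3)[OF xy] xy unfolding L'_def distrib_right by simp
          next
            case 2
            have "L x \<le> a k" "a k - L x \<le> C * (t - x)" using C(2,3)[OF xy(1) 2(1)] t by auto
            moreover have "C * (t - x) \<le> C * (y - x)" "c * (y - t) \<le> c * (y - x)" "0 \<le> c * (y - t)"
              using C(1) c0 2 by (auto intro!: mult_left_mono)
            ultimately show ?thesis using 2 unfolding L'_def distrib_right by (simp; linarith)
          next
            case 3
            have "c * (y - t) - c * (x - t) = c * (y - x)" by (simp add: algebra_simps)
            moreover have "0 \<le> c * (y - x)" "0 \<le> C * (y - x)" using c0 C(1) xy by auto
            ultimately show ?thesis using 3 xy unfolding L'_def distrib_right by (simp; linarith)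
          qed
        qed
        then show "\<exists>C\<ge>0. \<forall>x\<ge>0. \<forall>y\<ge>x. L' x \<le> L' y \<and> L' y - L' x \<le> C * (y - x)"
          using C(1) c0 by (intro exI[of _ "C + c"]) auto
        show "\<forall>i\<in>insert k S. L' 0 \<le> a i" using L0 L0k t by (auto simp: L'_def)
        show "u \<le> sum \<nu> (insert k S) \<longrightarrow> (\<forall>x\<ge>0. \<exists>i\<in>insert k S. L' x \<le> a i)"
        proof (intro impI allI)
          fix x :: real assume "u \<le> sum \<nu> (insert k S)" and x: "0 \<le> x"
          then have "u \<le> W" using 3(2) insert.hyps(1) by (simp add: W_def)
          then have "c = 0" using W by (simp add: c_def max_def field_simps)
          then have "L' x \<le> a k" using Lt x by (simp add: L'_def)
          then show "\<exists>i\<in>insert k S. L' x \<le> a i" by blast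
        qed
        show "\<forall>i\<in>insert k S. f' i \<in> borel_measurable borel \<and> (\<forall>x. 0 \<le> f' i x) \<and>
            (\<forall>x\<ge>0. f' i x > 0 \<longrightarrow> a i \<le> L' x)"
        proof (intro ballI conjI allI impI)
          fix i assume i: "i \<in> insert k S"
          have "(\<lambda>x. if i = k then 0 else f i x) \<in> borel_measurable borel" using fm i by auto
          then show "f' i \<in> borel_measurable borel" unfolding f'_def[abs_def] by measurable
          show "0 \<le> f' i x" for x using g0[OF i] f0 i by (auto simp: f'_def)
          fix x :: real assume x: "0 \<le> x" "0 < f' i x"
          show "a i \<le> L' x"
          proof (cases "x \<le> t")
            case True
            then show ?thesis using x fL[of i x] i by (auto simp: f'_def L'_def split: if_splits)
          next
            case False
            then have "0 \<le> c * (x - t)" using c0 by simp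
            then show ?thesis using False ak'[OF i] by (simp add: L'_def)
          qed
        qed
        show "\<forall>x\<ge>0. (\<Sum>i\<in>insert k S. f' i x) = u"
        proof (intro allI impI)
          fix x :: real assume x: "0 \<le> x"
          show "(\<Sum>i\<in>insert k S. f' i x) = u"
          proof (cases "x \<le> t")
            case True
            then have "(\<Sum>i\<in>S. f' i x) = (\<Sum>i\<in>S. f i x)"
              using 3(2) by (intro sum.cong) (auto simp: f'_def)
            then show ?thesis using True 3(2) insert.hyps(1) fsum[OF x] by (simp add: f'_def)
          next
            case False
            then show ?thesis using gsum by (simp add: f'_def)
          qed
        qed
        \<comment> \<open>The slope of the level may jump at \<open>t\<close>, so \<open>t\<close>
          joins the exceptional set.\<close>
        have "((\<lambda>x. \<nu> i * max (L' x - a i) 0) has_real_derivative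
          (if \<nu> i * max (L' x - a i) 0 > 0 then f' i x - \<nu> i else max (f' i x - \<nu> i) 0)) (at x)"
          if x: "x > 0" "x \<notin> insert t N" and i: "i \<in> insert k S" for x i
        proof (cases "x < t")
          case True
          show ?thesis
          proof (cases "i = k")
            case ik: True
            have "((\<lambda>x. \<nu> k * max (L' x - a k) 0) has_real_derivative 0) (at x)"
              by (rule has_real_derivative_cong_open[of "\<lambda>_. 0" _ _ "{0<..<t}"])
                (use x True Lt in \<open>auto simp: L'_def\<close>)
            then show ?thesis using ik True Lt[of x] x vk by (simp add: f'_def L'_def max_def)
          next
            case False
            then have "i \<in> S" using i by simp
            note d = N(2)[OF x(1) _ this]
            have "((\<lambda>x. \<nu> i * max (L' x - a i) 0) has_real_derivative
              (if \<nu> i * max (L x - a i) 0 > 0 then f i x - \<nu> i else max (f i x - \<nu> i) 0)) (at x)"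
              by (rule has_real_derivative_cong_open[OF d, of "{..<t}"])
                (use x True in \<open>auto simp: L'_def\<close>)
            moreover have "f' i x = f i x" "L' x = L x" using False True by (simp_all add: f'_def L'_def)
            ultimately show ?thesis by (simp only:)
          qed
        next
          case False
          then have xt: "x > t" using x by auto
          have vi: "\<nu> i > 0" using insert.prems(2)[OF i] .
          have pos: "0 \<le> a k - a i + c * (y - t)" if "y > t" for y
            using ak'[OF i] c0 that by (simp add: add_nonneg_nonneg)
          have "((\<lambda>x. \<nu> i * max (L' x - a i) 0) has_real_derivative \<nu> i * c) (at x)"
          proof (rule has_real_derivative_cong_open[of "\<lambda>x. \<nu> i * (a k - a i + c * (x - t))" _ _ "{t<..}"])
            show "((\<lambda>x. \<nu> i * (a k - a i + c * (x - t))) has_real_derivative \<nu> i * c) (at x)"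
              by (auto intro!: derivative_eq_intros)
            show "\<nu> i * max (L' y - a i) 0 = \<nu> i * (a k - a i + c * (y - t))" if "y \<in> {t<..}" for y
              using pos[of y] that by (simp add: L'_def max_def)
          qed (use xt in auto)
          moreover have "(if \<nu> i * max (L' x - a i) 0 > 0 then f' i x - \<nu> i else max (f' i x - \<nu> i) 0) = \<nu> i * c"
          proof (cases "W < u")
            case True
            then have c: "c = u / W - 1" "c > 0" using W by (simp_all add: c_def max_def field_simps)
            have "L' x - a i > 0"
              using xt ak'[OF i] mult_pos_pos[OF c(2), of "x - t"] by (simp add: L'_def)
            moreover have "f' i x = \<nu> i * (1 + c)" using True xt c(1) by (simp add: f'_def g_def)
            ultimately show ?thesis using vi by (simp add: distrib_left)
          next
            case False
            then have c: "c = 0" using W by (simp add: c_def max_def field_simps)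
            then have Lx: "L' x = a k" using xt by (simp add: L'_def)
            \<comment> \<open>All queues are constant: \<open>k\<close> has no queue and gets at
              most its capacity, since \<open>u \<le> W\<close>; the other links get exactly
              theirs.\<close>
            show ?thesis
            proof (cases "i = k")
              case True
              then show ?thesis using False xt Lx c by (simp add: f'_def g_def W_def)
            next
              case ik: False
              then show ?thesis using False xt c by (simp add: f'_def g_def)
            qed
          qed
          ultimately show ?thesis by simp
        qed
        then show "\<exists>N. finite N \<and> (\<forall>x>0. x \<notin> N \<longrightarrow> (\<forall>i\<in>insert k S.
          ((\<lambda>x. \<nu> i * max (L' x - a i) 0) has_real_derivative
          (if \<nu> i * max (L' x - a i) 0 > 0 then f' i x - \<nu> i else max (f' i x - \<nu> i) 0)) (at x)))"
          using N(1) by (intro exI[of _ "insert t N"]) blast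
      qed
      then show ?thesis by blast
    qed
  qed
qed

section \<open>Bayesian dynamic equilibria as instances of the abstract notion\<close>

lemma not_negligible_Icc: "a < b \<Longrightarrow> \<not> negligible {a..b::real}"
  using negligible_interval(1)[of a b] by (simp add: box_real)

lemma is_BDE_equilibrium:
  assumes bde: "is_BDE m d \<nu> u \<tau> \<mu> f z" and \<nu>: "\<forall>i\<in>{1..m}. \<nu> i > 0" and u: "u > 0" and m: "m \<ge> 1"
  shows "parallel_links.equilibrium {1..m} \<nu> u (\<lambda>i. \<Sum>s\<in>{1..d}. \<mu> s * \<tau> i s) T f z"
    and "i \<in> {1..m} \<Longrightarrow> z i 0 = 0"
proof -
  let ?a = "\<lambda>i. \<Sum>s\<in>{1..d}. \<mu> s * \<tau> i s"
  interpret parallel_links "{1..m}" \<nu> u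
    using \<nu> u m by unfold_locales auto
  have flow: "is_flow m u f" and queue: "is_queue m \<nu> f z" using bde by (auto simp: is_BDE_def)
  have z0: "z i 0 = 0" if "i \<in> {1..m}" for i using queue that by (auto simp: is_queue_def)
  then show "i \<in> {1..m} \<Longrightarrow> z i 0 = 0" .
  have 1: "AE \<theta> in lborel. 0 \<le> \<theta> \<longrightarrow> (\<Sum>i\<in>{1..m}. f i \<theta>) = u"
    using flow by (auto simp: is_flow_def)
  have 2: "AE \<theta> in lborel. \<forall>i\<in>{1..m}. 0 < \<theta> \<longrightarrow> (z i has_real_derivative
      (if z i \<theta> > 0 then f i \<theta> - \<nu> i else max (f i \<theta> - \<nu> i) 0)) (at \<theta>)"
    using queue by (intro AE_finite_allI) (auto simp: is_queue_def)
  have 3: "AE \<theta> in lborel. 0 \<le> \<theta> \<longrightarrow>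
        (\<forall>i\<in>{1..m}. f i \<theta> > 0 \<longrightarrow>
           (\<forall>j\<in>{1..m}. \<theta> + z i \<theta> / \<nu> i + ?a i \<le> \<theta> + z j \<theta> / \<nu> j + ?a j))"
    using bde by (auto simp: is_BDE_def)
  have bal: "balanced ?a f z \<theta>"
    if \<theta>: "0 < \<theta>" and sum: "(\<Sum>i\<in>{1..m}. f i \<theta>) = u"
      and der: "\<forall>i\<in>{1..m}. (z i has_real_derivative
        (if z i \<theta> > 0 then f i \<theta> - \<nu> i else max (f i \<theta> - \<nu> i) 0)) (at \<theta>)"
      and min: "\<forall>i\<in>{1..m}. f i \<theta> > 0 \<longrightarrow>
           (\<forall>j\<in>{1..m}. \<theta> + z i \<theta> / \<nu> i + ?a i \<le> \<theta> + z j \<theta> / \<nu> j + ?a j)" for \<theta>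
    unfolding balanced_def
  proof (intro conjI ballI impI sum)
    fix i assume i: "i \<in> {1..m}"
    show "0 \<le> f i \<theta>" using flow i \<theta> by (auto simp: is_flow_def)
    show "(z i has_real_derivative queue_rate f z i \<theta>) (at \<theta>)"
      using der i by (simp add: queue_rate_def)
    assume "0 < f i \<theta>"
    then have "z i \<theta> / \<nu> i + ?a i \<le> level ?a z \<theta>"
      using min i by (intro level_geI) fastforce
    then show "z i \<theta> / \<nu> i + ?a i = level ?a z \<theta>" using level_le[OF i, of ?a z \<theta>] by simp
  qed
  have "AE \<theta> in lborel. 0 < \<theta> \<longrightarrow> balanced ?a f z \<theta>"
    using 1 2 3
  proof eventually_elim
    case (elim \<theta>)
    then show ?case by (intro impI bal) simp_all
  qed
  then obtain N where "negligible N" "\<forall>\<theta>. \<theta> \<notin> N \<longrightarrow> 0 < \<theta> \<longrightarrow> balanced ?a f z \<theta>"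
    using AE_lborel_imp_negligible by blast
  then show "equilibrium ?a T f z"
    using queue z0 by (intro equilibriumI[of z N]) (auto simp: is_queue_def)
qed

text \<open>The flow may be altered at the single time \<open>T\<close>, so that \<open>makespan\<close>, which evaluates flows
  pointwise, counts every link at \<open>T\<close>.\<close>

lemma is_BDE_exists:
  assumes \<nu>: "\<forall>i\<in>{1..m}. \<nu> i > 0" and u: "u > 0" and m: "m \<ge> 1"
  shows "\<exists>f z. is_BDE m d \<nu> u \<tau> \<mu> f z \<and> (\<forall>i\<in>{1..m}. f i T > 0)"
proof -
  define S where "S = {1..m}"
  define a where "a i = (\<Sum>s\<in>{1..d}. \<mu> s * \<tau> i s)" for i
  obtain L f where wf: "water_filling S \<nu> u a L f"
    using water_filling_exists[of S \<nu> u a] \<nu> u m by (auto simp: S_def)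
  obtain C N where C: "C \<ge> 0" "\<And>x y. 0 \<le> x \<Longrightarrow> x \<le> y \<Longrightarrow> L x \<le> L y"
    "\<And>x y. 0 \<le> x \<Longrightarrow> x \<le> y \<Longrightarrow> L y - L x \<le> C * (y - x)"
    and L0: "\<And>i. i \<in> S \<Longrightarrow> L 0 \<le> a i"
    and fm: "\<And>i. i \<in> S \<Longrightarrow> f i \<in> borel_measurable borel"
    and f0: "\<And>i x. i \<in> S \<Longrightarrow> 0 \<le> f i x"
    and fL: "\<And>i x. i \<in> S \<Longrightarrow> x \<ge> 0 \<Longrightarrow> f i x > 0 \<Longrightarrow> a i \<le> L x"
    and fsum: "\<And>x. x \<ge> 0 \<Longrightarrow> (\<Sum>i\<in>S. f i x) = u"
    and N: "finite N" "\<And>x i. x > 0 \<Longrightarrow> x \<notin> N \<Longrightarrow> i \<in> S \<Longrightarrow>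
      ((\<lambda>x. \<nu> i * max (L x - a i) 0) has_real_derivative
      (if \<nu> i * max (L x - a i) 0 > 0 then f i x - \<nu> i else max (f i x - \<nu> i) 0)) (at x)"
    by (rule water_fillingE[OF wf]) (rule that)
  define z where "z i x = \<nu> i * max (L x - a i) 0" for i x
  have z_abs: "z i = (\<lambda>x. \<nu> i * max (L x - a i) 0)" for i by (simp add: z_def fun_eq_iff)
  \<comment> \<open>Any positive value would do at the null time \<open>T\<close>.\<close>
  define f' where "f' i x = (if x = T then 1 else f i x)" for i x
  have ae: "AE x in lborel. x \<notin> insert T N"
    using N(1) by (intro AE_not_in finite_imp_null_set_lborel) auto
  \<comment> \<open>With a common level the delay on a link is the larger of level and travel time,
    so links with \<open>a i \<le> L x\<close> are optimal.\<close>
  have zl: "z i x / \<nu> i + a i = max (L x) (a i)" if "i \<in> S" for i x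
  proof -
    have "\<nu> i > 0" using \<nu> that by (simp add: S_def)
    then show ?thesis by (auto simp: z_def max_def)
  qed
  have "is_flow m u f'"
    unfolding is_flow_def S_def[symmetric]
  proof (intro conjI ballI allI impI)
    fix i assume i: "i \<in> S"
    have "f' i \<in> borel_measurable borel" unfolding f'_def[abs_def] using fm[OF i] by measurable
    then show "f' i \<in> borel_measurable (restrict_space lborel {0..})"
      by (intro measurable_restrict_space1) simp
    show "0 \<le> f' i x" for x using f0[OF i] by (simp add: f'_def)
  next
    show "AE x in lborel. 0 \<le> x \<longrightarrow> (\<Sum>i\<in>S. f' i x) = u"
      using ae by eventually_elim (use fsum in \<open>auto simp: f'_def\<close>)
  qed
  moreover have "is_queue m \<nu> f' z"
    unfolding is_queue_def S_def[symmetric]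
  proof (intro conjI ballI allI impI)
    fix i assume i: "i \<in> S"
    have vi: "\<nu> i > 0" using \<nu> i by (simp add: S_def)
    show "z i 0 = 0" using L0[OF i] by (simp add: z_def)
    fix b :: real
    have "\<bar>z i x - z i y\<bar> \<le> \<nu> i * C * (y - x)" if "0 \<le> x" "x \<le> y" for x y
    proof -
      have "\<bar>max (L x - a i) 0 - max (L y - a i) 0\<bar> \<le> C * (y - x)" using C(2,3)[OF that] by linarith
      then have "\<nu> i * \<bar>max (L x - a i) 0 - max (L y - a i) 0\<bar> \<le> \<nu> i * (C * (y - x))"
        using vi by (intro mult_left_mono) auto
      then show ?thesis
        using vi by (simp add: z_def abs_mult right_diff_distrib[symmetric] mult.assoc)
    qed
    note lip = this
    have "(\<nu> i * C)-lipschitz_on {0..b} (z i)"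
    proof (rule lipschitz_onI)
      show "0 \<le> \<nu> i * C" using vi C(1) by simp
      fix x y assume xy: "x \<in> {0..b}" "y \<in> {0..b}"
      then show "dist (z i x) (z i y) \<le> \<nu> i * C * dist x y"
      proof (cases "x \<le> y")
        case True
        then show ?thesis using lip[of x y] xy by (simp add: dist_real_def)
      next
        case False
        then show ?thesis using lip[of y x] xy by (simp add: dist_real_def abs_minus_commute)
      qed
    qed
    then show "abs_cont_on_interval (z i) 0 b" by (rule lipschitz_on_imp_abs_cont_on_interval)
  next
    fix i assume i: "i \<in> S"
    show "AE x in lborel. 0 < x \<longrightarrow> (z i has_real_derivative
        (if z i x > 0 then f' i x - \<nu> i else max (f' i x - \<nu> i) 0)) (at x)"
      using ae
    proof eventually_elim
      case (elim x)
      then have "f' i x = f i x" "0 < x \<Longrightarrow> x \<notin> N" by (auto simp: f'_def)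
      then show ?case using N(2)[of x i] i by (simp only: z_abs) simp
    qed
  qed
  moreover have "AE x in lborel. 0 \<le> x \<longrightarrow> (\<forall>i\<in>S. f' i x > 0 \<longrightarrow>
      (\<forall>j\<in>S. x + z i x / \<nu> i + a i \<le> x + z j x / \<nu> j + a j))"
    using ae
  proof eventually_elim
    case (elim x)
    show ?case
    proof (intro impI ballI)
      fix i j assume x: "0 \<le> x" and i: "i \<in> S" "0 < f' i x" and j: "j \<in> S"
      have "a i \<le> L x" using fL[OF i(1) x] i(2) elim by (simp add: f'_def)
      then show "x + z i x / \<nu> i + a i \<le> x + z j x / \<nu> j + a j"
        using zl[OF i(1), of x] zl[OF j, of x] by simp
    qed
  qed
  ultimately have "is_BDE m d \<nu> u \<tau> \<mu> f' z" by (simp only: is_BDE_def a_def S_def)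
  then show ?thesis by (intro exI[of _ f'] exI[of _ z]) (simp add: f'_def)
qed

subsection \<open>Makespans\<close>

text \<open>By first-in-first-out, bounds at the horizon cover all earlier departures. The second
  conclusion provides the boundedness required for lower bounds on the supremum.\<close>

lemma makespan_le:
  assumes bde: "is_BDE m d \<nu> u \<tau> \<mu> f z" and \<nu>: "\<forall>i\<in>{1..m}. \<nu> i > 0" and u: "u > 0" and m: "m \<ge> 1"
    and T: "T > 0" and B: "\<And>i. i \<in> {1..m} \<Longrightarrow> T + z i T / \<nu> i + \<tau> i s \<le> B"
  shows "makespan m \<nu> \<tau> T s f z \<le> B"
    and "v \<in> {\<theta> + z i \<theta> / \<nu> i + \<tau> i s | \<theta> i. \<theta> \<in> {0..T} \<and> i \<in> {1..m} \<and> f i \<theta> > 0} \<Longrightarrow> v \<le> B"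
proof -
  let ?G = "{\<theta> + z i \<theta> / \<nu> i + \<tau> i s | \<theta> i. \<theta> \<in> {0..T} \<and> i \<in> {1..m} \<and> f i \<theta> > 0}"
  interpret parallel_links "{1..m}" \<nu> u
    using \<nu> u m by unfold_locales auto
  have up: "v \<le> B" if v: "v \<in> ?G" for v
  proof -
    obtain \<theta> i where \<theta>: "0 \<le> \<theta>" "\<theta> \<le> T" "i \<in> {1..m}" "v = \<theta> + z i \<theta> / \<nu> i + \<tau> i s"
      using v by auto
    then show ?thesis
      using equilibrium_link_time_mono[OF is_BDE_equilibrium(1)[OF bde \<nu> u m] \<theta>(3,1,2) order_refl] B[OF \<theta>(3)]
      by simp
  qed
  then show "v \<in> ?G \<Longrightarrow> v \<le> B" .
  \<comment> \<open>The inflow \<open>u\<close> is positive at almost every time in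
    \<open>{0..T}\<close>, a set of positive measure, so some link is used.\<close>
  have "?G \<noteq> {}"
  proof -
    have "AE \<theta> in lborel. 0 \<le> \<theta> \<longrightarrow> (\<Sum>i\<in>{1..m}. f i \<theta>) = u"
      using bde by (auto simp: is_BDE_def is_flow_def)
    then obtain N where N: "negligible N" "\<And>\<theta>. \<theta> \<notin> N \<Longrightarrow> 0 \<le> \<theta> \<Longrightarrow> (\<Sum>i\<in>{1..m}. f i \<theta>) = u"
      using AE_lborel_imp_negligible by blast
    have "\<not> {0..T} \<subseteq> N"
    proof
      assume "{0..T} \<subseteq> N"
      then have "negligible {0..T}" by (rule negligible_subset[OF N(1)])
      then show False using T not_negligible_Icc by blast
    qed
    then obtain \<theta> where \<theta>: "\<theta> \<in> {0..T}" "\<theta> \<notin> N" by blast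
    have "\<exists>i\<in>{1..m}. f i \<theta> > 0"
    proof (rule ccontr)
      assume "\<not> (\<exists>i\<in>{1..m}. f i \<theta> > 0)"
      then have "(\<Sum>i\<in>{1..m}. f i \<theta>) \<le> 0" by (intro sum_nonpos) (auto simp: not_less)
      then show False using N(2)[of \<theta>] \<theta> u by simp
    qed
    then show ?thesis using \<theta>(1) by blast
  qed
  then show "makespan m \<nu> \<tau> T s f z \<le> B"
    unfolding makespan_def using up by (rule cSup_least)
qed

lemma makespan_ge:
  assumes bde: "is_BDE m d \<nu> u \<tau> \<mu> f z" and \<nu>: "\<forall>i\<in>{1..m}. \<nu> i > 0" and u: "u > 0" and m: "m \<ge> 1"
    and T: "T > 0" and i: "i \<in> {1..m}" "f i T > 0"
  shows "T + z i T / \<nu> i + \<tau> i s \<le> makespan m \<nu> \<tau> T s f z"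
proof -
  let ?G = "{\<theta> + z i \<theta> / \<nu> i + \<tau> i s | \<theta> i. \<theta> \<in> {0..T} \<and> i \<in> {1..m} \<and> f i \<theta> > 0}"
  have "T + z i T / \<nu> i + \<tau> i s \<le> Max ((\<lambda>i. T + z i T / \<nu> i + \<tau> i s) ` {1..m})"
    if "i \<in> {1..m}" for i
    using that by (intro Max_ge) auto
  from makespan_le(2)[OF bde \<nu> u m T this] have "bdd_above ?G"
    by (auto simp: bdd_above_def simp del: atLeastAtMost_iff)
  moreover have "T + z i T / \<nu> i + \<tau> i s \<in> ?G"
    using i T by (intro CollectI exI[of _ T] exI[of _ i]) auto
  ultimately show ?thesis unfolding makespan_def by (intro cSup_upper)
qed

text \<open>Since \<open>g\<close> is positive on every link at \<open>T\<close>, its makespan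
  bounds the scenario-\<open>s\<close> arrival times on all links. This makes
  \<open>V = makespan - T\<close> admissible in \<open>equilibrium_delay_le\<close>, with scenario
  \<open>s\<close> against the belief \<mu>.\<close>

lemma worst_exp_makespan_unit_vec_le:
  assumes bde: "is_BDE m d \<nu> u \<tau> \<mu> g y" and gT: "\<forall>i\<in>{1..m}. g i T > 0"
    and \<nu>: "\<forall>i\<in>{1..m}. \<nu> i > 0" and u: "u > 0" and m: "m \<ge> 1"
    and T: "T > 0" and s: "s \<in> {1..d}"
  shows "worst_exp_makespan m d \<nu> u \<tau> T (unit_vec s) \<le> makespan m \<nu> \<tau> T s g y"
proof -
  let ?M = "makespan m \<nu> \<tau> T s g y"
  interpret parallel_links "{1..m}" \<nu> u
    using \<nu> u m by unfold_locales auto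
  have unit: "(\<Sum>t\<in>{1..d}. unit_vec s t * c t) = c s" for c :: "nat \<Rightarrow> real"
  proof -
    have "(\<Sum>t\<in>{1..d}. unit_vec s t * c t) = (\<Sum>t\<in>{1..d}. if t = s then c t else 0)"
      by (intro sum.cong) (auto simp: unit_vec_def)
    then show ?thesis using s by simp
  qed
  have "makespan m \<nu> \<tau> T s f z \<le> ?M" if bde': "is_BDE m d \<nu> u \<tau> (unit_vec s) f z" for f z
  proof (rule makespan_le(1)[OF bde' \<nu> u m T])
    fix i assume i: "i \<in> {1..m}"
    have "equilibrium (\<lambda>i. \<tau> i s) T f z"
      using is_BDE_equilibrium(1)[OF bde' \<nu> u m, of T] by (simp only: unit)
    from equilibrium_delay_le[OF this is_BDE_equilibrium(2)[OF bde' \<nu> u m]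
        is_BDE_equilibrium(1)[OF bde \<nu> u m] is_BDE_equilibrium(2)[OF bde \<nu> u m], of "?M - T" i]
    show "T + z i T / \<nu> i + \<tau> i s \<le> ?M"
      using makespan_ge[OF bde \<nu> u m T] gT i T by (force simp: algebra_simps)
  qed
  \<comment> \<open>Bounding the supremum from above requires its set to be nonempty.\<close>
  moreover obtain f0 z0 where "is_BDE m d \<nu> u \<tau> (unit_vec s) f0 z0"
    using is_BDE_exists[OF \<nu> u m] by blast
  ultimately show ?thesis
    unfolding worst_exp_makespan_def unit by (intro cSup_least) auto
qed

text \<open>The point is boundedness of the set behind the supremum.
  \<open>equilibrium_delay_le\<close> with identical travel times on both sides bounds the final
  delays of every equilibrium for \<mu> by those of \<open>y\<close>.\<close>

lemma expected_makespan_le_worst: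
  assumes bde: "is_BDE m d \<nu> u \<tau> \<mu> g y" and \<mu>: "\<mu> \<in> beliefs d"
    and \<nu>: "\<forall>i\<in>{1..m}. \<nu> i > 0" and u: "u > 0" and m: "m \<ge> 1" and T: "T > 0"
  shows "(\<Sum>s\<in>{1..d}. \<mu> s * makespan m \<nu> \<tau> T s g y) \<le> worst_exp_makespan m d \<nu> u \<tau> T \<mu>"
proof -
  let ?a = "\<lambda>i. \<Sum>s\<in>{1..d}. \<mu> s * \<tau> i s"
  interpret parallel_links "{1..m}" \<nu> u
    using \<nu> u m by unfold_locales auto
  define V where "V = Max ((\<lambda>i. y i T / \<nu> i + ?a i) ` {1..m})"
  have V: "y i T / \<nu> i + ?a i \<le> V" if "i \<in> {1..m}" for i
    unfolding V_def using that by (intro Max_ge) auto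
  \<comment> \<open>Exchanges the expected travel time in the delay bound for the one of scenario
    \<open>s\<close>.\<close>
  define B where "B s = Max ((\<lambda>i. T + (V - ?a i) + \<tau> i s) ` {1..m})" for s
  have B: "T + (V - ?a i) + \<tau> i s \<le> B s" if "i \<in> {1..m}" for i s
    unfolding B_def using that by (intro Max_ge) auto
  have "(\<Sum>s\<in>{1..d}. \<mu> s * makespan m \<nu> \<tau> T s f z) \<le> (\<Sum>s\<in>{1..d}. \<mu> s * B s)"
    if bde': "is_BDE m d \<nu> u \<tau> \<mu> f z" for f z
  proof (intro sum_mono mult_left_mono)
    fix s assume "s \<in> {1..d}"
    then show "0 \<le> \<mu> s" using \<mu> by (auto simp: beliefs_def)
    show "makespan m \<nu> \<tau> T s f z \<le> B s"
    proof (rule makespan_le(1)[OF bde' \<nu> u m T])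
      fix i assume i: "i \<in> {1..m}"
      have "z i T / \<nu> i + ?a i \<le> V"
        using equilibrium_delay_le[OF is_BDE_equilibrium[OF bde' \<nu> u m] is_BDE_equilibrium[OF bde \<nu> u m] _ V i] T
        by simp
      then show "T + z i T / \<nu> i + \<tau> i s \<le> B s" using B[OF i, of s] by simp
    qed
  qed
  then have "bdd_above {(\<Sum>s\<in>{1..d}. \<mu> s * makespan m \<nu> \<tau> T s f z) | f z. is_BDE m d \<nu> u \<tau> \<mu> f z}"
    by (auto simp: bdd_above_def)
  then show ?thesis
    unfolding worst_exp_makespan_def using bde by (intro cSup_upper) auto
qed

theorem mainTheorem5:
  fixes m d :: nat and \<nu> :: "nat \<Rightarrow> real" and u T :: real and \<tau> :: "nat \<Rightarrow> nat \<Rightarrow> real"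
    and lam :: "nat \<Rightarrow> real" and X :: "'x set" and \<alpha> :: "'x \<Rightarrow> real" and post :: "'x \<Rightarrow> nat \<Rightarrow> real"
  assumes nu: "\<forall>i\<in>{1..m}. \<nu> i \<in> \<rat> \<and> \<nu> i > 0"
    and u: "u \<in> \<rat>" "u > 0"
    and tau: "\<forall>i\<in>{1..m}. \<forall>s\<in>{1..d}. \<tau> i s \<in> \<rat> \<and> \<tau> i s \<ge> 0"
    and T: "T > 0"
    and prior: "lam \<in> beliefs d"
    and fin: "finite X"
    and alpha: "\<forall>\<xi>\<in>X. 0 \<le> \<alpha> \<xi> \<and> \<alpha> \<xi> \<le> 1"
    and post: "\<forall>\<xi>\<in>X. post \<xi> \<in> beliefs d"
    and sum1: "(\<Sum>\<xi>\<in>X. \<alpha> \<xi>) = 1"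
    and bayes: "\<forall>s\<in>{1..d}. (\<Sum>\<xi>\<in>X. \<alpha> \<xi> * post \<xi> s) = lam s"
  shows "(\<Sum>\<xi>\<in>X. \<alpha> \<xi> * worst_exp_makespan m d \<nu> u \<tau> T (post \<xi>))
           \<ge> (\<Sum>s\<in>{1..d}. lam s * worst_exp_makespan m d \<nu> u \<tau> T (unit_vec s))"
proof (cases "m = 0")
  case True
  \<comment> \<open>No flow exists, and every worst-case makespan is the junk value \<open>Sup {}\<close>.\<close>
  have "\<not> is_BDE m d \<nu> u \<tau> \<mu> f z" for \<mu> f z
  proof
    assume "is_BDE m d \<nu> u \<tau> \<mu> f z"
    then have "AE \<theta> in lborel. 0 \<le> \<theta> \<longrightarrow> (\<Sum>i\<in>{1..m}. f i \<theta>) = u"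
      by (simp only: is_BDE_def is_flow_def)
    then obtain N where N: "negligible N" "\<forall>\<theta>. \<theta> \<notin> N \<longrightarrow> 0 \<le> \<theta> \<longrightarrow> (\<Sum>i\<in>{1..m}. f i \<theta>) = u"
      using AE_lborel_imp_negligible by blast
    have "\<theta> \<in> N" if "0 \<le> \<theta>" for \<theta>
      using N(2) that True u(2) by force
    then have "negligible {0..1::real}" by (intro negligible_subset[OF N(1)]) auto
    then show False using not_negligible_Icc[of 0 1] by simp
  qed
  then have "worst_exp_makespan m d \<nu> u \<tau> T \<mu> = Sup {}" for \<mu>
    by (simp add: worst_exp_makespan_def)
  then show ?thesis
    using sum1 prior by (simp add: beliefs_def flip: sum_distrib_right)
next
  case False
  then have m: "m \<ge> 1" by simp
  have \<nu>: "\<forall>i\<in>{1..m}. \<nu> i > 0" using nu by blast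
  let ?M = "worst_exp_makespan m d \<nu> u \<tau> T"
  \<comment> \<open>One equilibrium for \<mu>, used on every link at \<open>T\<close>, serves all
    scenarios simultaneously, so the scenario bounds can be averaged.\<close>
  have post_ge: "(\<Sum>s\<in>{1..d}. \<mu> s * ?M (unit_vec s)) \<le> ?M \<mu>" if \<mu>: "\<mu> \<in> beliefs d" for \<mu>
  proof -
    obtain g y where gy: "is_BDE m d \<nu> u \<tau> \<mu> g y" "\<forall>i\<in>{1..m}. g i T > 0"
      using is_BDE_exists[OF \<nu> u(2) m] by blast
    have "(\<Sum>s\<in>{1..d}. \<mu> s * ?M (unit_vec s)) \<le> (\<Sum>s\<in>{1..d}. \<mu> s * makespan m \<nu> \<tau> T s g y)"
      using \<mu> worst_exp_makespan_unit_vec_le[OF gy \<nu> u(2) m T]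
      by (intro sum_mono mult_left_mono) (auto simp: beliefs_def)
    also have "\<dots> \<le> ?M \<mu>"
      using gy(1) \<mu> \<nu> u(2) m T by (rule expected_makespan_le_worst)
    finally show ?thesis .
  qed
  \<comment> \<open>Writing the prior as the average of the posteriors turns the cost of full
    revelation into the same average of the left-hand sides of \<open>post_ge\<close>.\<close>
  have "(\<Sum>s\<in>{1..d}. lam s * ?M (unit_vec s))
      = (\<Sum>s\<in>{1..d}. \<Sum>\<xi>\<in>X. \<alpha> \<xi> * (post \<xi> s * ?M (unit_vec s)))"
  proof (intro sum.cong refl)
    fix s assume "s \<in> {1..d}"
    then have "lam s = (\<Sum>\<xi>\<in>X. \<alpha> \<xi> * post \<xi> s)" using bayes by simp
    then show "lam s * ?M (unit_vec s) = (\<Sum>\<xi>\<in>X. \<alpha> \<xi> * (post \<xi> s * ?M (unit_vec s)))"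
      by (simp only: sum_distrib_right mult.assoc)
  qed
  also have "\<dots> = (\<Sum>\<xi>\<in>X. \<alpha> \<xi> * (\<Sum>s\<in>{1..d}. post \<xi> s * ?M (unit_vec s)))"
    by (subst sum.swap) (simp add: sum_distrib_left)
  also have "\<dots> \<le> (\<Sum>\<xi>\<in>X. \<alpha> \<xi> * ?M (post \<xi>))"
    using alpha post post_ge by (intro sum_mono mult_left_mono) auto
  finally show ?thesis .
qed

end
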